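(* Let $\mathcal L\subset\mathfrak F(\Omega)$ be a vector lattice containing $\mathcal B_*$, $C\subset\mathcal L$ a convex set containing the origin, and $\gamma:\mathcal L\to\mathbb R$ a $\ge_*$-monotone, subadditive and positively homogeneous functional. Then $$\gamma\Big(\sum_{n=1}^Nf_n\Big)=\sum_{n=1}^N\gamma(f_n)\qquad\text{for all }N\text{ and }f_1,\ldots,f_N\in C$$ if and only if there exist (i) a positive linear functional $\beta$ on $\mathcal L$ vanishing on $\mathcal B_*$ and (ii) $m\in ba_{*,+}$ with $\mathcal L\subset L^1(m)$, such that $$\gamma(h)\ge\beta(h)+\int h\,dm\quad\text{and}\quad\gamma(f)=\beta(f)+\int f\,dm\qquad\text{for all }h\in\mathcal L,\ f\in C.$$
   Context: $\Omega$ is a nonempty set, $\mathfrak F(\Omega)$ the real functions on $\Omega$ (inequalities, $|\cdot|$ pointwise; constants are constant functions). $\ge_*$ is a reflexive, transitive relation on $\mathfrak F(\Omega)$ with (TRIV) $0\not\ge_*1$; (CONE) $f_i\ge_*g_i$, $a_i\ge0$ ($i=1,2$) imply $a_1f_1+a_2f_2\ge_*a_1g_1+a_2g_2$; (CERT) $f\ge0\Rightarrow f\ge_*0$; (APPR) $f+2^{-n}\ge_*0$ for all $n$ implies $f\ge_*0$; (REST) $f\ge_*0$, $A\subset\Omega$ imply $f1_A\ge_*0$. $\mathcal N_*=\{A:0\ge_*1_A\}$, $\mathcal B_*=\{f:\eta\ge_*|f|\text{ for some real }\eta>0\}$, $ba_{*,+}$ = nonnegative bounded finitely additive set functions on all subsets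 of $\Omega$ vanishing on $\mathcal N_*$. $\gamma$ is $\ge_*$-monotone if $f\ge_*g$ implies $\gamma(f)\ge\gamma(g)$. A positive linear functional $\beta$ satisfies $\beta(f)\ge0$ whenever $f\ge0$. Integrals: $\int f\,dm:=\lim_n\int[(f^+\wedge n)-(f^-\wedge n)]dm$ if the limit exists in $[-\infty,\infty]$, else $\infty$; $L^1(m)$ is the space of $m$-integrable functions (Dunford–Schwartz). *)

theory Defs
  imports "HOL-Analysis.Analysis"
begin

text \<open>Omega is the (nonempty) type 'a; real functions on Omega are 'a \<Rightarrow> real.
  ge f g encodes f \<ge>_* g.\<close>

definition star_order :: "(('a \<Rightarrow> real) \<Rightarrow> ('a \<Rightarrow> real) \<Rightarrow> bool) \<Rightarrow> bool" where
  "star_order ge \<longleftrightarrow>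
     (\<forall>f. ge f f) \<and>
     (\<forall>f g h. ge f g \<longrightarrow> ge g h \<longrightarrow> ge f h) \<and>
     \<not> ge (\<lambda>_. 0) (\<lambda>_. 1) \<and>
     (\<forall>f1 g1 f2 g2 a1 a2. ge f1 g1 \<longrightarrow> ge f2 g2 \<longrightarrow> a1 \<ge> 0 \<longrightarrow> a2 \<ge> 0 \<longrightarrow>
        ge (\<lambda>x. a1 * f1 x + a2 * f2 x) (\<lambda>x. a1 * g1 x + a2 * g2 x)) \<and>
     (\<forall>f. (\<forall>x. f x \<ge> 0) \<longrightarrow> ge f (\<lambda>_. 0)) \<and>
     (\<forall>f. (\<forall>n::nat. ge (\<lambda>x. f x + (1/2)^n) (\<lambda>_. 0)) \<longrightarrow> ge f (\<lambda>_. 0)) \<and>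
     (\<forall>f A. ge f (\<lambda>_. 0) \<longrightarrow> ge (\<lambda>x. f x * indicator A x) (\<lambda>_. 0))"

definition null_sets_star :: "(('a \<Rightarrow> real) \<Rightarrow> ('a \<Rightarrow> real) \<Rightarrow> bool) \<Rightarrow> 'a set set" where
  "null_sets_star ge = {A. ge (\<lambda>_. 0) (indicator A)}"

definition bounded_star :: "(('a \<Rightarrow> real) \<Rightarrow> ('a \<Rightarrow> real) \<Rightarrow> bool) \<Rightarrow> ('a \<Rightarrow> real) set" where
  "bounded_star ge = {f. \<exists>\<eta>::real. \<eta> > 0 \<and> ge (\<lambda>_. \<eta>) (\<lambda>x. \<bar>f x\<bar>)}"

text \<open>ba_{*,+}: nonnegative bounded finitely additive set functions on all subsets,
  vanishing on the ge-null sets.\<close>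
definition ba_star_plus :: "(('a \<Rightarrow> real) \<Rightarrow> ('a \<Rightarrow> real) \<Rightarrow> bool) \<Rightarrow> ('a set \<Rightarrow> real) set" where
  "ba_star_plus ge = {m. (\<forall>A. m A \<ge> 0) \<and>
      (\<forall>A B. A \<inter> B = {} \<longrightarrow> m (A \<union> B) = m A + m B) \<and>
      (\<exists>K. \<forall>A. m A \<le> K) \<and>
      (\<forall>A \<in> null_sets_star ge. m A = 0)}"

text \<open>Dunford--Schwartz integration w.r.t. a finitely additive m on the power set.\<close>
definition simple_fn :: "('a \<Rightarrow> real) \<Rightarrow> bool" where
  "simple_fn f \<longleftrightarrow> finite (range f)"

definition simple_int :: "('a set \<Rightarrow> real) \<Rightarrow> ('a \<Rightarrow> real) \<Rightarrow> real" where
  "simple_int m f = (\<Sum>v\<in>range f. v * m (f -` {v}))"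

definition conv_in_measure :: "('a set \<Rightarrow> real) \<Rightarrow> (nat \<Rightarrow> 'a \<Rightarrow> real) \<Rightarrow> ('a \<Rightarrow> real) \<Rightarrow> bool" where
  "conv_in_measure m fs f \<longleftrightarrow>
     (\<forall>\<epsilon>>0. (\<lambda>n. m {x. \<bar>fs n x - f x\<bar> > \<epsilon>}) \<longlonglongrightarrow> 0)"

definition ds_approx :: "('a set \<Rightarrow> real) \<Rightarrow> (nat \<Rightarrow> 'a \<Rightarrow> real) \<Rightarrow> ('a \<Rightarrow> real) \<Rightarrow> bool" where
  "ds_approx m fs f \<longleftrightarrow> (\<forall>n. simple_fn (fs n)) \<and> conv_in_measure m fs f \<and>
     (\<forall>e>0. \<exists>N. \<forall>n\<ge>N. \<forall>k\<ge>N. simple_int m (\<lambda>x. \<bar>fs n x - fs k x\<bar>) < e)"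

text \<open>L^1(m): the m-integrable functions in the sense of Dunford--Schwartz.\<close>
definition L1 :: "('a set \<Rightarrow> real) \<Rightarrow> ('a \<Rightarrow> real) set" where
  "L1 m = {f. \<exists>fs. ds_approx m fs f}"

definition ds_integral :: "('a set \<Rightarrow> real) \<Rightarrow> ('a \<Rightarrow> real) \<Rightarrow> real" where
  "ds_integral m f = (THE I. \<exists>fs. ds_approx m fs f \<and> (\<lambda>n. simple_int m (fs n)) \<longlonglongrightarrow> I)"

text \<open>The integral of the paper: limit of integrals of the truncations
  (f^+ min n) - (f^- min n) if it exists in the extended reals, otherwise +\<infinity>.\<close>
definition trunc_fn :: "nat \<Rightarrow> ('a \<Rightarrow> real) \<Rightarrow> 'a \<Rightarrow> real" where
  "trunc_fn n f = (\<lambda>x. min (max (f x) 0) (real n) - min (max (- f x) 0) (real n))"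

definition integral_star :: "('a set \<Rightarrow> real) \<Rightarrow> ('a \<Rightarrow> real) \<Rightarrow> ereal" where
  "integral_star m f =
     (if (\<exists>l::ereal. (\<lambda>n. ereal (ds_integral m (trunc_fn n f))) \<longlonglongrightarrow> l)
      then lim (\<lambda>n. ereal (ds_integral m (trunc_fn n f))) else \<infinity>)"

definition vector_lattice :: "('a \<Rightarrow> real) set \<Rightarrow> bool" where
  "vector_lattice L \<longleftrightarrow> (\<lambda>_. 0) \<in> L \<and>
     (\<forall>f\<in>L. \<forall>g\<in>L. (\<lambda>x. f x + g x) \<in> L) \<and>
     (\<forall>f\<in>L. \<forall>c::real. (\<lambda>x. c * f x) \<in> L) \<and>
     (\<forall>f\<in>L. \<forall>g\<in>L. (\<lambda>x. max (f x) (g x)) \<in> L) \<and>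
     (\<forall>f\<in>L. \<forall>g\<in>L. (\<lambda>x. min (f x) (g x)) \<in> L)"

definition convex_fn_set :: "('a \<Rightarrow> real) set \<Rightarrow> bool" where
  "convex_fn_set C \<longleftrightarrow> (\<forall>f\<in>C. \<forall>g\<in>C. \<forall>t::real. 0 \<le> t \<longrightarrow> t \<le> 1 \<longrightarrow>
     (\<lambda>x. t * f x + (1 - t) * g x) \<in> C)"

definition star_monotone_on ::
  "(('a \<Rightarrow> real) \<Rightarrow> ('a \<Rightarrow> real) \<Rightarrow> bool) \<Rightarrow> ('a \<Rightarrow> real) set \<Rightarrow> (('a \<Rightarrow> real) \<Rightarrow> real) \<Rightarrow> bool" where
  "star_monotone_on ge L \<gamma> \<longleftrightarrow> (\<forall>f\<in>L. \<forall>g\<in>L. ge f g \<longrightarrow> \<gamma> f \<ge> \<gamma> g)"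

definition subadditive_on :: "('a \<Rightarrow> real) set \<Rightarrow> (('a \<Rightarrow> real) \<Rightarrow> real) \<Rightarrow> bool" where
  "subadditive_on L \<gamma> \<longleftrightarrow> (\<forall>f\<in>L. \<forall>g\<in>L. \<gamma> (\<lambda>x. f x + g x) \<le> \<gamma> f + \<gamma> g)"

definition pos_homogeneous_on :: "('a \<Rightarrow> real) set \<Rightarrow> (('a \<Rightarrow> real) \<Rightarrow> real) \<Rightarrow> bool" where
  "pos_homogeneous_on L \<gamma> \<longleftrightarrow> (\<forall>f\<in>L. \<forall>c::real. c > 0 \<longrightarrow> \<gamma> (\<lambda>x. c * f x) = c * \<gamma> f)"

definition positive_linear_on :: "('a \<Rightarrow> real) set \<Rightarrow> (('a \<Rightarrow> real) \<Rightarrow> real) \<Rightarrow> bool" where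
  "positive_linear_on L \<beta> \<longleftrightarrow>
     (\<forall>f\<in>L. \<forall>g\<in>L. \<beta> (\<lambda>x. f x + g x) = \<beta> f + \<beta> g) \<and>
     (\<forall>f\<in>L. \<forall>c::real. \<beta> (\<lambda>x. c * f x) = c * \<beta> f) \<and>
     (\<forall>f\<in>L. (\<forall>x. f x \<ge> 0) \<longrightarrow> \<beta> f \<ge> 0)"

end

theory Submission
  imports Defs
begin

text \<open>Additivity on \<open>C\<close> extends to the convex cone \<open>K\<close> generated by \<open>C\<close>, so
  \<open>h \<mapsto> inf\<^sub>k (\<gamma> (h + k) - \<gamma> k)\<close>, with \<open>k\<close> ranging over \<open>K\<close>, is sublinear. A linear functional
  \<open>\<phi>\<close> below it (Hahn--Banach) satisfies \<open>\<phi> \<le> \<gamma>\<close>, with equality on \<open>C\<close>, and inherits monotonicity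
  from \<open>\<gamma>\<close>. Put \<open>m A = \<phi> 1\<^sub>A\<close>. The integral against \<open>m\<close> is the limit of \<open>\<phi>\<close> along truncations,
  hence it is dominated by \<open>\<phi>\<close> on nonnegative functions, and \<open>\<beta> = \<phi> - \<integral> \<cdot> dm\<close> is positive. A function in
  \<open>\<B>\<^sub>*\<close> agrees with its high truncations up to a negligible function, so \<open>\<beta>\<close> vanishes there.
  Conversely, \<open>\<beta> + \<integral> \<cdot> dm\<close> is a linear minorant of \<open>\<gamma>\<close> that touches \<open>\<gamma>\<close> on \<open>C\<close>, which forces
  the reverse of subadditivity.\<close>

section \<open>Finitely additive integration\<close>

lemma simple_fn_comp2:
  assumes "simple_fn f" "simple_fn g"
  shows "simple_fn (\<lambda>x. u (f x) (g x))"
proof -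
  have "range (\<lambda>x. u (f x) (g x)) \<subseteq> (\<lambda>(a, b). u a b) ` (range f \<times> range g)"
    by auto
  then show ?thesis
    using assms unfolding simple_fn_def by (meson finite_SigmaI finite_imageI finite_subset)
qed

lemma simple_fn_const: "simple_fn (\<lambda>_. c)"
  by (simp add: simple_fn_def)

lemma simple_fn_comp: "simple_fn f \<Longrightarrow> simple_fn (\<lambda>x. u (f x))"
  using simple_fn_comp2[of f f "\<lambda>a b. u a"] by simp

lemma simple_fn_indicator: "simple_fn (indicator A)"
proof -
  have "range (indicator A :: 'a \<Rightarrow> real) \<subseteq> {0, 1}"
    by (auto simp: indicator_def)
  then show ?thesis
    unfolding simple_fn_def using finite_subset by blast
qed

lemma simple_fn_bounded:
  assumes "simple_fn f"
  obtains M where "M \<ge> 0" "\<And>x. \<bar>f x\<bar> \<le> M"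
proof
  have fin: "finite (range (\<lambda>x. \<bar>f x\<bar>))"
    using simple_fn_comp[OF assms, of abs] by (simp add: simple_fn_def)
  then show b: "\<bar>f x\<bar> \<le> Max (range (\<lambda>x. \<bar>f x\<bar>))" for x
    by (intro Max_ge) auto
  show "0 \<le> Max (range (\<lambda>x. \<bar>f x\<bar>))"
    using b abs_ge_zero order_trans by blast
qed

text \<open>Rounding down to the grid of mesh \<open>2^-n\<close>: the error is uniform in the
  argument, and a bounded function meets only finitely many grid points.\<close>

definition step_approx :: "nat \<Rightarrow> ('a \<Rightarrow> real) \<Rightarrow> 'a \<Rightarrow> real" where
  "step_approx n f = (\<lambda>x. of_int \<lfloor>2 ^ n * f x\<rfloor> / 2 ^ n)"

lemma step_approx_close: "\<bar>step_approx n f x - f x\<bar> \<le> (1/2) ^ n"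
proof -
  have "\<bar>of_int \<lfloor>2 ^ n * f x\<rfloor> - 2 ^ n * f x\<bar> \<le> 1"
    by linarith
  then have "\<bar>of_int \<lfloor>2 ^ n * f x\<rfloor> - 2 ^ n * f x\<bar> / 2 ^ n \<le> 1 / 2 ^ n"
    by (intro divide_right_mono) auto
  moreover have "\<bar>of_int \<lfloor>2 ^ n * f x\<rfloor> - 2 ^ n * f x\<bar> / 2 ^ n = \<bar>step_approx n f x - f x\<bar>"
    by (simp add: step_approx_def field_simps flip: abs_divide)
  ultimately show ?thesis
    by (simp add: power_divide)
qed

lemma simple_fn_step_approx:
  assumes "\<And>x. \<bar>f x\<bar> \<le> K"
  shows "simple_fn (step_approx n f)"
proof -
  have "\<lfloor>2 ^ n * f x\<rfloor> \<in> {\<lfloor>- (2 ^ n * K)\<rfloor> .. \<lfloor>2 ^ n * K\<rfloor>}" for x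
  proof -
    have "- K \<le> f x" "f x \<le> K"
      using assms[of x] by linarith+
    then have "2 ^ n * f x \<le> 2 ^ n * K" "- (2 ^ n * K) \<le> 2 ^ n * f x"
      using mult_left_mono[of "- K" "f x" "2 ^ n"] by auto
    then show ?thesis
      using floor_mono by (metis atLeastAtMost_iff)
  qed
  then have "range (step_approx n f) \<subseteq>
      (\<lambda>i::int. of_int i / 2 ^ n) ` {\<lfloor>- (2 ^ n * K)\<rfloor> .. \<lfloor>2 ^ n * K\<rfloor>}"
    by (auto simp: step_approx_def)
  then show ?thesis
    unfolding simple_fn_def by (meson finite_atLeastAtMost_int finite_imageI finite_subset)
qed

text \<open>Seen as a clamp to \<open>[-n, n]\<close>, the truncation is 1-Lipschitz, which is what
  lets it act on approximating sequences.\<close>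

lemma trunc_fn_clamp: "trunc_fn n f x = max (- real n) (min (real n) (f x))"
  by (simp add: trunc_fn_def max_def min_def)

lemma trunc_fn_bound: "\<bar>trunc_fn n f x\<bar> \<le> real n"
  by (auto simp: trunc_fn_clamp max_def min_def)

lemma trunc_fn_eq: "\<bar>f x\<bar> \<le> real n \<Longrightarrow> trunc_fn n f x = f x"
  by (auto simp: trunc_fn_clamp max_def min_def)

lemma clamp_lipschitz: "\<bar>max l (min u a) - max l (min u b)\<bar> \<le> \<bar>a - b\<bar>" for l u a b :: real
  by (simp add: max_def min_def)

lemma trunc_fn_lipschitz: "\<bar>trunc_fn n f x - trunc_fn n g x\<bar> \<le> \<bar>f x - g x\<bar>"
  unfolding trunc_fn_clamp by (rule clamp_lipschitz)

section \<open>Finitely additive set functions: simple integrals and their Dunford-Schwartz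
  limits\<close>

locale fin_additive =
  fixes m :: "'a set \<Rightarrow> real"
  assumes nonneg: "m A \<ge> 0"
    and Un_disjoint: "A \<inter> B = {} \<Longrightarrow> m (A \<union> B) = m A + m B"
begin

lemma empty: "m {} = 0"
  using Un_disjoint[of "{}" "{}"] by simp

lemma mono: "A \<subseteq> B \<Longrightarrow> m A \<le> m B"
  using Un_disjoint[of A "B - A"] nonneg[of "B - A"] by (simp add: Un_absorb1)

lemma subadditive: "m (A \<union> B) \<le> m A + m B"
  using Un_disjoint[of A "B - A"] mono[of "B - A" B] by auto

lemma UN_disjoint:
  assumes "finite I" "\<And>i j. i \<in> I \<Longrightarrow> j \<in> I \<Longrightarrow> i \<noteq> j \<Longrightarrow> A i \<inter> A j = {}"
  shows "m (\<Union>i\<in>I. A i) = (\<Sum>i\<in>I. m (A i))"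
  using assms
proof (induction I rule: finite_induct)
  case (insert i I)
  have "A i \<inter> A j = {}" if "j \<in> I" for j
    using that insert.hyps(2) by (intro insert.prems) auto
  then have "A i \<inter> (\<Union>j\<in>I. A j) = {}"
    by blast
  moreover have "m (\<Union>j\<in>I. A j) = (\<Sum>j\<in>I. m (A j))"
    by (rule insert.IH, rule insert.prems) auto
  ultimately show ?case
    using insert.hyps by (simp add: Un_disjoint)
qed (simp add: empty)

text \<open>Regroup the level sets of \<open>g\<close> by the value of \<open>u\<close>: each level
  set of the composition is a finite disjoint union of level sets of \<open>g\<close>, and
  \<open>m\<close> is additive on it.\<close>

lemma simple_int_comp:
  assumes "finite (range g)"
  shows "simple_int m (\<lambda>x. u (g x)) = (\<Sum>w\<in>range g. u w * m (g -` {w}))"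
proof -
  have "(\<Sum>w\<in>range g. u w * m (g -` {w}))
      = (\<Sum>v\<in>u ` range g. \<Sum>w\<in>{w \<in> range g. u w = v}. u w * m (g -` {w}))"
    by (rule sum.image_gen[OF assms])
  also have "\<dots> = (\<Sum>v\<in>u ` range g. v * m ((\<lambda>x. u (g x)) -` {v}))"
  proof (rule sum.cong[OF refl])
    fix v
    have "(\<lambda>x. u (g x)) -` {v} = (\<Union>w\<in>{w \<in> range g. u w = v}. g -` {w})"
      by auto
    moreover have "m (\<Union>w\<in>{w \<in> range g. u w = v}. g -` {w})
        = (\<Sum>w\<in>{w \<in> range g. u w = v}. m (g -` {w}))"
      using assms by (intro UN_disjoint) auto
    ultimately show "(\<Sum>w\<in>{w \<in> range g. u w = v}. u w * m (g -` {w}))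
        = v * m ((\<lambda>x. u (g x)) -` {v})"
      by (simp add: sum_distrib_left)
  qed
  also have "u ` range g = range (\<lambda>x. u (g x))"
    by auto
  finally show ?thesis
    by (simp add: simple_int_def)
qed

text \<open>The joint level sets of \<open>f\<close> and \<open>g\<close> form one partition on
  which every function of the pair can be integrated, so linearity and monotonicity become termwise
  facts about finite sums.\<close>

lemma simple_int_comp2:
  assumes "simple_fn f" "simple_fn g"
  shows "simple_int m (\<lambda>x. u (f x) (g x)) =
    (\<Sum>w\<in>range (\<lambda>x. (f x, g x)). u (fst w) (snd w) * m ((\<lambda>x. (f x, g x)) -` {w}))"
proof -
  have "range (\<lambda>x. (f x, g x)) \<subseteq> range f \<times> range g"
    by auto
  then have "finite (range (\<lambda>x. (f x, g x)))"
    using assms unfolding simple_fn_def by (meson finite_SigmaI finite_subset)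
  from simple_int_comp[OF this, of "\<lambda>w. u (fst w) (snd w)"] show ?thesis
    by simp
qed

lemma simple_int_add:
  assumes "simple_fn f" "simple_fn g"
  shows "simple_int m (\<lambda>x. f x + g x) = simple_int m f + simple_int m g"
  using simple_int_comp2[OF assms, of "\<lambda>a b. a + b"] simple_int_comp2[OF assms, of "\<lambda>a b. a"]
    simple_int_comp2[OF assms, of "\<lambda>a b. b"]
  by (simp add: sum.distrib distrib_right)

lemma simple_int_scale:
  assumes "simple_fn f"
  shows "simple_int m (\<lambda>x. c * f x) = c * simple_int m f"
  using simple_int_comp2[OF assms assms, of "\<lambda>a b. c * a"]
    simple_int_comp2[OF assms assms, of "\<lambda>a b. a"]
  by (simp add: sum_distrib_left mult.assoc)

lemma simple_int_diff:
  assumes "simple_fn f" "simple_fn g"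
  shows "simple_int m (\<lambda>x. f x - g x) = simple_int m f - simple_int m g"
  using simple_int_add[OF assms(1) simple_fn_comp[OF assms(2), of "\<lambda>a. -1 * a"]]
    simple_int_scale[OF assms(2), of "-1"] by simp

lemma simple_int_mono:
  assumes "simple_fn f" "simple_fn g" "\<And>x. f x \<le> g x"
  shows "simple_int m f \<le> simple_int m g"
proof -
  have "(\<Sum>w\<in>range (\<lambda>x. (f x, g x)). fst w * m ((\<lambda>x. (f x, g x)) -` {w}))
      \<le> (\<Sum>w\<in>range (\<lambda>x. (f x, g x)). snd w * m ((\<lambda>x. (f x, g x)) -` {w}))"
    using assms(3) by (intro sum_mono mult_right_mono) (auto simp: nonneg)
  then show ?thesis
    using simple_int_comp2[OF assms(1,2), of "\<lambda>a b. a"]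
      simple_int_comp2[OF assms(1,2), of "\<lambda>a b. b"] by simp
qed

lemma simple_int_const: "simple_int m (\<lambda>_. c) = c * m UNIV"
  by (simp add: simple_int_def)

lemma simple_int_indicator: "simple_int m (indicator A) = m A"
proof -
  have "finite (range (\<lambda>x. x \<in> A))"
    by simp
  then have "simple_int m (\<lambda>x. of_bool (x \<in> A)) =
      (\<Sum>w\<in>range (\<lambda>x. x \<in> A). of_bool w * m ((\<lambda>x. x \<in> A) -` {w}))"
    using simple_int_comp by blast
  \<comment> \<open>If \<open>A\<close> is empty or the whole space, one truth value is missing from
    the range; its level set is empty and contributes 0.\<close>
  also have "\<dots> = (\<Sum>w\<in>UNIV. of_bool w * m ((\<lambda>x. x \<in> A) -` {w}))"
  proof (rule sum.mono_neutral_left)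
    show "\<forall>w\<in>UNIV - range (\<lambda>x. x \<in> A). of_bool w * m ((\<lambda>x. x \<in> A) -` {w}) = 0"
    proof
      fix w assume "w \<in> UNIV - range (\<lambda>x. x \<in> A)"
      then have "(\<lambda>x. x \<in> A) -` {w} = {}"
        by blast
      then show "of_bool w * m ((\<lambda>x. x \<in> A) -` {w}) = 0"
        by (simp add: empty)
    qed
  qed auto
  also have "\<dots> = m A"
    by (simp add: UNIV_bool vimage_def)
  also have "(\<lambda>x. of_bool (x \<in> A)) = (indicator A :: 'a \<Rightarrow> real)"
    by (auto simp: indicator_def)
  finally show ?thesis .
qed

lemma simple_int_abs_le:
  assumes "simple_fn f"
  shows "\<bar>simple_int m f\<bar> \<le> simple_int m (\<lambda>x. \<bar>f x\<bar>)"
proof -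
  have s: "simple_fn (\<lambda>x. \<bar>f x\<bar>)" "simple_fn (\<lambda>x. -1 * f x)"
    by (intro simple_fn_comp[OF assms])+
  have "simple_int m f \<le> simple_int m (\<lambda>x. \<bar>f x\<bar>)"
    by (rule simple_int_mono[OF assms s(1)]) auto
  moreover have "simple_int m (\<lambda>x. -1 * f x) \<le> simple_int m (\<lambda>x. \<bar>f x\<bar>)"
    by (rule simple_int_mono[OF s(2,1)]) auto
  ultimately show ?thesis
    using simple_int_scale[OF assms, of "-1"] by linarith
qed

lemma simple_int_abs_diff_le:
  assumes "simple_fn f" "simple_fn g"
  shows "\<bar>simple_int m f - simple_int m g\<bar> \<le> simple_int m (\<lambda>x. \<bar>f x - g x\<bar>)"
  using simple_int_abs_le[OF simple_fn_comp2[OF assms, of "\<lambda>a b. a - b"]] simple_int_diff[OF assms]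
  by simp

text \<open>The mean-Cauchy property compares \<open>hs n\<close> with one fixed, hence bounded,
  \<open>hs N\<close>. Where \<open>\<bar>hs n\<bar>\<close> exceeds a small \<open>d\<close>, the
  bound \<open>M\<close> of \<open>hs N\<close> is multiplied by a vanishing measure; elsewhere
  \<open>\<bar>hs n\<bar>\<close> is at most \<open>d\<close>.\<close>

lemma ds_approx_null_mean:
  assumes "ds_approx m hs (\<lambda>_. 0)"
  shows "(\<lambda>n. simple_int m (hs n)) \<longlonglongrightarrow> 0"
proof (rule LIMSEQ_I)
  fix e :: real assume e: "e > 0"
  have simp: "simple_fn (hs n)" for n
    using assms by (simp add: ds_approx_def)
  obtain N where N: "\<And>n k. n \<ge> N \<Longrightarrow> k \<ge> N \<Longrightarrow> simple_int m (\<lambda>x. \<bar>hs n x - hs k x\<bar>) < e / 3"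
    using assms e unfolding ds_approx_def by (meson divide_pos_pos zero_less_numeral)
  obtain M where M: "M \<ge> 0" "\<And>x. \<bar>hs N x\<bar> \<le> M"
    using simple_fn_bounded[OF simp] by blast
  \<comment> \<open>Chosen so that the constant \<open>d\<close> integrates to at most
    \<open>e / 3\<close>; the added 1 keeps the denominator positive when \<open>m UNIV\<close> is
    0.\<close>
  define d where "d = e / (3 * (m UNIV + 1))"
  have d: "d > 0" "d * m UNIV \<le> e / 3"
    using e nonneg[of UNIV] by (auto simp: d_def field_simps add_pos_nonneg)
  define E where "E n = {x. \<bar>hs n x\<bar> > d}" for n
  have "(\<lambda>n. m (E n)) \<longlonglongrightarrow> 0"
    using assms d(1) unfolding ds_approx_def conv_in_measure_def E_def by simp
  then have "(\<lambda>n. M * m (E n)) \<longlonglongrightarrow> 0"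
    using tendsto_mult_right_zero by blast
  then obtain N' where N': "\<And>n. n \<ge> N' \<Longrightarrow> M * m (E n) < e / 3"
    using e order_tendstoD(2)[of _ 0 sequentially "e/3"] unfolding eventually_sequentially by auto
  have "norm (simple_int m (hs n) - 0) < e" if n: "n \<ge> max N N'" for n
  proof -
    define D where "D = (\<lambda>x. \<bar>hs n x - hs N x\<bar>)"
    define F where "F = (\<lambda>x. M * indicator (E n) x :: real)"
    have sD: "simple_fn D"
      unfolding D_def by (rule simple_fn_comp2[OF simp simp])
    have sF: "simple_fn F"
      unfolding F_def by (rule simple_fn_comp[OF simple_fn_indicator])
    have sDF: "simple_fn (\<lambda>x. D x + F x)"
      by (rule simple_fn_comp2[OF sD sF])
    have sDFd: "simple_fn (\<lambda>x. D x + F x + d)"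
      by (rule simple_fn_comp[OF sDF])
    have "\<bar>simple_int m (hs n)\<bar> \<le> simple_int m (\<lambda>x. \<bar>hs n x\<bar>)"
      by (rule simple_int_abs_le[OF simp])
    also have "\<dots> \<le> simple_int m (\<lambda>x. D x + F x + d)"
    proof (rule simple_int_mono[OF simple_fn_comp[OF simp] sDFd])
      fix x
      show "\<bar>hs n x\<bar> \<le> D x + F x + d"
        using M(2)[of x] M(1) d(1) by (cases "x \<in> E n") (auto simp: D_def F_def E_def)
    qed
    also have "\<dots> = simple_int m D + simple_int m F + d * m UNIV"
      using simple_int_add[OF sDF simple_fn_const, of d] simple_int_add[OF sD sF]
      by (simp add: simple_int_const)
    also have "simple_int m F = M * m (E n)"
      unfolding F_def using simple_int_scale[OF simple_fn_indicator] simple_int_indicator by metis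
    also have "simple_int m D + M * m (E n) + d * m UNIV < e"
      using N[of n N] N'[of n] n d(2) unfolding D_def by auto
    finally show ?thesis
      by simp
  qed
  then show "\<exists>no. \<forall>n\<ge>no. norm (simple_int m (hs n) - 0) < e"
    by blast
qed

text \<open>A Lipschitz map carries both convergence in measure and the mean-Cauchy property. One
  statement thus covers sums, differences, scalar multiples and truncations.\<close>

lemma ds_approx_comp2:
  assumes f: "ds_approx m fs f" and g: "ds_approx m gs g"
    and K: "K > 0" "\<And>a a' b b'. \<bar>u a b - u a' b'\<bar> \<le> K * (\<bar>a - a'\<bar> + \<bar>b - b'\<bar> :: real)"
  shows "ds_approx m (\<lambda>n x. u (fs n x) (gs n x)) (\<lambda>x. u (f x) (g x) :: real)"
  unfolding ds_approx_def conv_in_measure_def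
proof (intro conjI allI impI)
  have sf: "simple_fn (fs n)" and sg: "simple_fn (gs n)" for n
    using f g by (auto simp: ds_approx_def)
  show "simple_fn (\<lambda>x. u (fs n x) (gs n x))" for n
    by (rule simple_fn_comp2[OF sf sg])
  fix e :: real assume e: "e > 0"
  then have e': "e / (2 * K) > 0"
    using K by simp
  \<comment> \<open>With this threshold, a deviation of \<open>u\<close> above \<open>e\<close>
    forces one of its two arguments to deviate by more than \<open>e / (2 * K)\<close>.\<close>
  have "(\<lambda>n. m {x. \<bar>fs n x - f x\<bar> > e / (2 * K)}) \<longlonglongrightarrow> 0"
    "(\<lambda>n. m {x. \<bar>gs n x - g x\<bar> > e / (2 * K)}) \<longlonglongrightarrow> 0"
    using f g e' by (auto simp: ds_approx_def conv_in_measure_def)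
  from tendsto_add[OF this]
  have lim: "(\<lambda>n. m {x. \<bar>fs n x - f x\<bar> > e / (2 * K)} + m {x. \<bar>gs n x - g x\<bar> > e / (2 * K)})
      \<longlonglongrightarrow> 0"
    by simp
  show "(\<lambda>n. m {x. \<bar>u (fs n x) (gs n x) - u (f x) (g x)\<bar> > e}) \<longlonglongrightarrow> 0"
  proof (rule tendsto_sandwich[OF _ _ tendsto_const lim])
    show "\<forall>\<^sub>F n in sequentially. m {x. \<bar>u (fs n x) (gs n x) - u (f x) (g x)\<bar> > e}
      \<le> m {x. \<bar>fs n x - f x\<bar> > e / (2 * K)} + m {x. \<bar>gs n x - g x\<bar> > e / (2 * K)}"
    proof (intro always_eventually allI order_trans[OF mono subadditive] subsetI)
      fix n x assume "x \<in> {x. \<bar>u (fs n x) (gs n x) - u (f x) (g x)\<bar> > e}"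
      then have "e < K * (\<bar>fs n x - f x\<bar> + \<bar>gs n x - g x\<bar>)"
        using K(2)[of "fs n x" "gs n x" "f x" "g x"] by simp
      then have "e / (2 * K) + e / (2 * K) < \<bar>fs n x - f x\<bar> + \<bar>gs n x - g x\<bar>"
        using K(1) by (simp add: field_simps)
      then show "x \<in> {x. \<bar>fs n x - f x\<bar> > e / (2 * K)} \<union> {x. \<bar>gs n x - g x\<bar> > e / (2 * K)}"
        by auto
    qed
  qed (simp add: nonneg)
  obtain N1 where N1: "\<And>n k. n \<ge> N1 \<Longrightarrow> k \<ge> N1 \<Longrightarrow>
      simple_int m (\<lambda>x. \<bar>fs n x - fs k x\<bar>) < e / (2 * K)"
    using f e' unfolding ds_approx_def by meson
  obtain N2 where N2: "\<And>n k. n \<ge> N2 \<Longrightarrow> k \<ge> N2 \<Longrightarrow>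
      simple_int m (\<lambda>x. \<bar>gs n x - gs k x\<bar>) < e / (2 * K)"
    using g e' unfolding ds_approx_def by meson
  have "simple_int m (\<lambda>x. \<bar>u (fs n x) (gs n x) - u (fs k x) (gs k x)\<bar>) < e"
    if "n \<ge> max N1 N2" "k \<ge> max N1 N2" for n k
  proof -
    define F where "F = (\<lambda>x. \<bar>fs n x - fs k x\<bar>)"
    define G where "G = (\<lambda>x. \<bar>gs n x - gs k x\<bar>)"
    have sF: "simple_fn F" and sG: "simple_fn G"
      unfolding F_def G_def by (intro simple_fn_comp2[OF sf sf] simple_fn_comp2[OF sg sg])+
    have sFG: "simple_fn (\<lambda>x. F x + G x)"
      by (rule simple_fn_comp2[OF sF sG])
    have "simple_fn (\<lambda>x. u (fs n x) (gs n x))" "simple_fn (\<lambda>x. u (fs k x) (gs k x))"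
      by (rule simple_fn_comp2[OF sf sg])+
    from simple_fn_comp2[OF this, of "\<lambda>a b. \<bar>a - b\<bar>"]
    have "simple_int m (\<lambda>x. \<bar>u (fs n x) (gs n x) - u (fs k x) (gs k x)\<bar>)
        \<le> simple_int m (\<lambda>x. K * (F x + G x))"
      using K(2) by (intro simple_int_mono simple_fn_comp[OF sFG]) (auto simp: F_def G_def)
    also have "\<dots> = K * (simple_int m F + simple_int m G)"
      by (simp add: simple_int_scale[OF sFG] simple_int_add[OF sF sG])
    also have "\<dots> < K * (e / (2 * K) + e / (2 * K))"
      using N1[of n k] N2[of n k] that K(1) unfolding F_def G_def
      by (intro mult_strict_left_mono add_strict_mono) auto
    also have "\<dots> = e"
      using K(1) by (simp add: field_simps)
    finally show ?thesis .
  qed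
  then show "\<exists>N. \<forall>n\<ge>N. \<forall>k\<ge>N.
      simple_int m (\<lambda>x. \<bar>u (fs n x) (gs n x) - u (fs k x) (gs k x)\<bar>) < e"
    by blast
qed

lemma ds_approx_convergent:
  assumes "ds_approx m fs f"
  shows "convergent (\<lambda>n. simple_int m (fs n))"
proof (rule Cauchy_convergent, rule CauchyI)
  fix e :: real assume "e > 0"
  then obtain N where N: "\<And>n k. n \<ge> N \<Longrightarrow> k \<ge> N \<Longrightarrow> simple_int m (\<lambda>x. \<bar>fs n x - fs k x\<bar>) < e"
    using assms unfolding ds_approx_def by meson
  have "norm (simple_int m (fs n) - simple_int m (fs k)) < e" if "n \<ge> N" "k \<ge> N" for n k
    using simple_int_abs_diff_le[of "fs n" "fs k"] N[OF that] assms by (simp add: ds_approx_def)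
  then show "\<exists>M. \<forall>n\<ge>M. \<forall>k\<ge>M. norm (simple_int m (fs n) - simple_int m (fs k)) < e"
    by blast
qed

text \<open>The difference of the two sequences approximates 0, so its simple integrals vanish in
  the limit. This makes the definite description in \<open>ds_integral\<close> well defined.\<close>

lemma ds_approx_unique:
  assumes "ds_approx m fs f" "ds_approx m gs f"
    and "(\<lambda>n. simple_int m (fs n)) \<longlonglongrightarrow> I" "(\<lambda>n. simple_int m (gs n)) \<longlonglongrightarrow> J"
  shows "I = J"
proof -
  have "ds_approx m (\<lambda>n x. fs n x - gs n x) (\<lambda>x. f x - f x)"
    by (rule ds_approx_comp2[OF assms(1,2), of 1]) auto
  then have "(\<lambda>n. simple_int m (\<lambda>x. fs n x - gs n x)) \<longlonglongrightarrow> 0"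
    by (intro ds_approx_null_mean) simp
  moreover have "simple_int m (\<lambda>x. fs n x - gs n x) = simple_int m (fs n) - simple_int m (gs n)" for n
    using assms(1,2) by (intro simple_int_diff) (auto simp: ds_approx_def)
  ultimately have "(\<lambda>n. simple_int m (fs n) - simple_int m (gs n)) \<longlonglongrightarrow> 0"
    by simp
  then show ?thesis
    using LIMSEQ_unique[OF _ tendsto_diff[OF assms(3,4)]] by fastforce
qed

lemma ds_integral_eq:
  assumes "ds_approx m fs f" "(\<lambda>n. simple_int m (fs n)) \<longlonglongrightarrow> I"
  shows "ds_integral m f = I"
  unfolding ds_integral_def using assms ds_approx_unique by (intro the_equality) blast+

lemma ds_integral_tendsto:
  assumes "ds_approx m fs f"
  shows "(\<lambda>n. simple_int m (fs n)) \<longlonglongrightarrow> ds_integral m f"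
  using ds_approx_convergent[OF assms] ds_integral_eq[OF assms] unfolding convergent_def by metis

lemma L1_add:
  assumes "f \<in> L1 m" "g \<in> L1 m"
  shows "(\<lambda>x. f x + g x) \<in> L1 m"
    and "ds_integral m (\<lambda>x. f x + g x) = ds_integral m f + ds_integral m g"
proof -
  obtain fs gs where fs: "ds_approx m fs f" and gs: "ds_approx m gs g"
    using assms by (auto simp: L1_def)
  have a: "ds_approx m (\<lambda>n x. fs n x + gs n x) (\<lambda>x. f x + g x)"
    by (rule ds_approx_comp2[OF fs gs, of 1]) auto
  then show "(\<lambda>x. f x + g x) \<in> L1 m"
    by (auto simp: L1_def)
  have "simple_int m (\<lambda>x. fs n x + gs n x) = simple_int m (fs n) + simple_int m (gs n)" for n
    using fs gs by (intro simple_int_add) (auto simp: ds_approx_def)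
  then show "ds_integral m (\<lambda>x. f x + g x) = ds_integral m f + ds_integral m g"
    using ds_integral_tendsto[OF fs] ds_integral_tendsto[OF gs]
    by (intro ds_integral_eq[OF a]) (simp add: tendsto_add)
qed

lemma L1_scale:
  assumes "f \<in> L1 m"
  shows "ds_integral m (\<lambda>x. c * f x) = c * ds_integral m f"
proof -
  obtain fs where fs: "ds_approx m fs f"
    using assms by (auto simp: L1_def)
  have a: "ds_approx m (\<lambda>n x. c * fs n x) (\<lambda>x. c * f x)"
  proof (rule ds_approx_comp2[OF fs fs, where K = "\<bar>c\<bar> + 1" and u = "\<lambda>a b. c * a"])
    fix a a' b b' :: real
    have "\<bar>c * a - c * a'\<bar> = \<bar>c\<bar> * \<bar>a - a'\<bar>"
      by (simp add: abs_mult flip: right_diff_distrib)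
    also have "\<dots> \<le> (\<bar>c\<bar> + 1) * (\<bar>a - a'\<bar> + \<bar>b - b'\<bar>)"
      by (intro mult_mono) auto
    finally show "\<bar>c * a - c * a'\<bar> \<le> (\<bar>c\<bar> + 1) * (\<bar>a - a'\<bar> + \<bar>b - b'\<bar>)" .
  qed auto
  have "simple_int m (\<lambda>x. c * fs n x) = c * simple_int m (fs n)" for n
    using fs by (intro simple_int_scale) (auto simp: ds_approx_def)
  then show ?thesis
    using ds_integral_tendsto[OF fs]
    by (intro ds_integral_eq[OF a]) (simp add: tendsto_mult_left)
qed

text \<open>Fix one simple \<open>fs N\<close> whose mean distance to all later \<open>fs j\<close>
  is below \<open>e / 3\<close>. Truncation above its bound leaves \<open>fs N\<close> unchanged and
  does not increase distances, so the integrals of \<open>f\<close> and of its truncation both lie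
  within \<open>e / 3\<close> of that of \<open>fs N\<close>.\<close>

lemma ds_integral_trunc_tendsto:
  assumes "f \<in> L1 m"
  shows "(\<lambda>n. ds_integral m (trunc_fn n f)) \<longlonglongrightarrow> ds_integral m f"
proof (rule LIMSEQ_I)
  fix e :: real assume "e > 0"
  then have e: "e / 3 > 0"
    by simp
  obtain fs where fs: "ds_approx m fs f"
    using assms by (auto simp: L1_def)
  then have s: "simple_fn (fs n)" for n
    by (simp add: ds_approx_def)
  obtain N where N: "\<And>n k. n \<ge> N \<Longrightarrow> k \<ge> N \<Longrightarrow> simple_int m (\<lambda>x. \<bar>fs n x - fs k x\<bar>) < e / 3"
    using fs e unfolding ds_approx_def by meson
  obtain M where M: "\<And>x. \<bar>fs N x\<bar> \<le> M"
    using simple_fn_bounded[OF s] by metis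
  have 1: "\<bar>ds_integral m f - simple_int m (fs N)\<bar> \<le> e / 3"
  proof (rule tendsto_upperbound)
    show "(\<lambda>j. \<bar>simple_int m (fs j) - simple_int m (fs N)\<bar>)
        \<longlonglongrightarrow> \<bar>ds_integral m f - simple_int m (fs N)\<bar>"
      by (intro tendsto_intros ds_integral_tendsto[OF fs])
    show "\<forall>\<^sub>F j in sequentially. \<bar>simple_int m (fs j) - simple_int m (fs N)\<bar> \<le> e / 3"
      using eventually_ge_at_top[of N]
    proof eventually_elim
      case (elim j)
      then show ?case
        using simple_int_abs_diff_le[OF s s, of j N] N[of j N] by simp
    qed
  qed simp
  have 2: "\<bar>ds_integral m (trunc_fn n f) - simple_int m (fs N)\<bar> \<le> e / 3" if n: "real n \<ge> M" for n
  proof (rule tendsto_upperbound)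
    have "ds_approx m (\<lambda>j x. trunc_fn n (fs j) x) (\<lambda>x. trunc_fn n f x)"
      unfolding trunc_fn_clamp
      by (rule ds_approx_comp2[OF fs fs, of 1]) (auto intro: order_trans[OF clamp_lipschitz])
    then show "(\<lambda>j. \<bar>simple_int m (trunc_fn n (fs j)) - simple_int m (fs N)\<bar>)
        \<longlonglongrightarrow> \<bar>ds_integral m (trunc_fn n f) - simple_int m (fs N)\<bar>"
      by (intro tendsto_intros ds_integral_tendsto) simp
    show "\<forall>\<^sub>F j in sequentially. \<bar>simple_int m (trunc_fn n (fs j)) - simple_int m (fs N)\<bar> \<le> e / 3"
      using eventually_ge_at_top[of N]
    proof eventually_elim
      case (elim j)
      have t: "simple_fn (trunc_fn n (fs j))"
        unfolding trunc_fn_def by (rule simple_fn_comp[OF s])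
      have "\<bar>simple_int m (trunc_fn n (fs j)) - simple_int m (fs N)\<bar>
          \<le> simple_int m (\<lambda>x. \<bar>trunc_fn n (fs j) x - fs N x\<bar>)"
        by (rule simple_int_abs_diff_le[OF t s])
      also have "\<dots> \<le> simple_int m (\<lambda>x. \<bar>fs j x - fs N x\<bar>)"
      proof (rule simple_int_mono[OF simple_fn_comp2[OF t s] simple_fn_comp2[OF s s]])
        fix x
        have "trunc_fn n (fs N) x = fs N x"
          using M[of x] n by (intro trunc_fn_eq) linarith
        then show "\<bar>trunc_fn n (fs j) x - fs N x\<bar> \<le> \<bar>fs j x - fs N x\<bar>"
          using trunc_fn_lipschitz[of n "fs j" x "fs N"] by simp
      qed
      finally show ?case
        using N[OF elim, of N] by simp
    qed
  qed simp
  have "norm (ds_integral m (trunc_fn n f) - ds_integral m f) < e" if "n \<ge> nat \<lceil>M\<rceil>" for n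
  proof -
    have "real n \<ge> M"
      using that by (simp add: nat_ceiling_le_eq)
    then show ?thesis
      using 1 2[of n] e unfolding real_norm_def by linarith
  qed
  then show "\<exists>no. \<forall>n\<ge>no. norm (ds_integral m (trunc_fn n f) - ds_integral m f) < e"
    by blast
qed

text \<open>The truncated integrals have a real limit, so the extended-real limit exists and equals
  it.\<close>

lemma integral_star_eq_ds_integral:
  assumes "f \<in> L1 m"
  shows "integral_star m f = ereal (ds_integral m f)"
proof -
  have "(\<lambda>n. ereal (ds_integral m (trunc_fn n f))) \<longlonglongrightarrow> ereal (ds_integral m f)"
    using ds_integral_trunc_tendsto[OF assms] by simp
  then show ?thesis
    unfolding integral_star_def using limI by auto
qed

end

section \<open>Hahn--Banach on spaces of functions\<close>

locale function_subspace =
  fixes L :: "('a \<Rightarrow> real) set"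
  assumes zero: "(\<lambda>_. 0) \<in> L"
    and add: "f \<in> L \<Longrightarrow> g \<in> L \<Longrightarrow> (\<lambda>x. f x + g x) \<in> L"
    and scale: "f \<in> L \<Longrightarrow> (\<lambda>x. c * f x) \<in> L"
begin

lemma minus: "f \<in> L \<Longrightarrow> (\<lambda>x. - f x) \<in> L"
  using scale[of f "-1"] by simp

lemma diff: "f \<in> L \<Longrightarrow> g \<in> L \<Longrightarrow> (\<lambda>x. f x - g x) \<in> L"
  using add[of f "\<lambda>x. - g x"] minus[of g] by simp

lemma sum: "(\<And>i. i \<in> I \<Longrightarrow> f i \<in> L) \<Longrightarrow> (\<lambda>x. \<Sum>i\<in>I. f i x) \<in> L"
  by (induction I rule: infinite_finite_induct) (auto intro: zero add)

definition linear_functional :: "(('a \<Rightarrow> real) \<Rightarrow> real) \<Rightarrow> bool" where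
  "linear_functional p \<longleftrightarrow> (\<forall>f\<in>L. \<forall>g\<in>L. p (\<lambda>x. f x + g x) = p f + p g) \<and>
     (\<forall>f\<in>L. \<forall>c. p (\<lambda>x. c * f x) = c * p f)"

lemma linearD:
  assumes "linear_functional p"
  shows "f \<in> L \<Longrightarrow> g \<in> L \<Longrightarrow> p (\<lambda>x. f x + g x) = p f + p g"
    and "f \<in> L \<Longrightarrow> p (\<lambda>x. c * f x) = c * p f"
  using assms by (auto simp: linear_functional_def)

lemma linear_minus: "linear_functional p \<Longrightarrow> f \<in> L \<Longrightarrow> p (\<lambda>x. - f x) = - p f"
  using linearD(2)[of p f "-1"] by simp

lemma linear_zero: "linear_functional p \<Longrightarrow> p (\<lambda>_. 0) = 0"
  using linearD(2)[OF _ zero, of p 0] by simp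

lemma linear_diff:
  "linear_functional p \<Longrightarrow> f \<in> L \<Longrightarrow> g \<in> L \<Longrightarrow> p (\<lambda>x. f x - g x) = p f - p g"
  using linearD(1)[of p f "\<lambda>x. - g x"] minus[of g] linear_minus[of p g] by simp

lemma linear_sum:
  assumes "linear_functional p" "\<And>i. i \<in> I \<Longrightarrow> f i \<in> L"
  shows "p (\<lambda>x. \<Sum>i\<in>I. f i x) = (\<Sum>i\<in>I. p (f i))"
  using assms(2)
  by (induction I rule: infinite_finite_induct)
    (auto simp: linear_zero[OF assms(1)] linearD(1)[OF assms(1)] sum)

definition sublinear :: "(('a \<Rightarrow> real) \<Rightarrow> real) \<Rightarrow> bool" where
  "sublinear p \<longleftrightarrow> subadditive_on L p \<and> pos_homogeneous_on L p"

lemma sublinearD: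
  assumes "sublinear p"
  shows "f \<in> L \<Longrightarrow> g \<in> L \<Longrightarrow> p (\<lambda>x. f x + g x) \<le> p f + p g"
    and "f \<in> L \<Longrightarrow> c > 0 \<Longrightarrow> p (\<lambda>x. c * f x) = c * p f"
  using assms by (auto simp: sublinear_def subadditive_on_def pos_homogeneous_on_def)

text \<open>One inequality suffices for homogeneity: applied to \<open>c f\<close> with the factor
  \<open>1 / c\<close> it gives the reverse one.\<close>

lemma sublinearI:
  assumes add: "\<And>f g. f \<in> L \<Longrightarrow> g \<in> L \<Longrightarrow> p (\<lambda>x. f x + g x) \<le> p f + p g"
    and le: "\<And>f c. f \<in> L \<Longrightarrow> c > 0 \<Longrightarrow> p (\<lambda>x. c * f x) \<le> c * p f"
  shows "sublinear p"
proof -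
  have "p (\<lambda>x. c * f x) = c * p f" if f: "f \<in> L" and c: "c > 0" for f c
  proof (rule antisym[OF le[OF f c]])
    have "p (\<lambda>x. (1 / c) * (c * f x)) \<le> (1 / c) * p (\<lambda>x. c * f x)"
      using c by (intro le scale f) auto
    then show "c * p f \<le> p (\<lambda>x. c * f x)"
      using c by (simp add: field_simps)
  qed
  then show ?thesis
    using add by (auto simp: sublinear_def subadditive_on_def pos_homogeneous_on_def)
qed

lemma sublinear_zero:
  assumes "sublinear p"
  shows "p (\<lambda>_. 0) = 0"
  using sublinearD(2)[OF assms zero, of 2] by simp

lemma sublinear_ge_minus:
  assumes "sublinear p" "f \<in> L"
  shows "- p (\<lambda>x. - f x) \<le> p f"
  using sublinearD(1)[OF assms(1) assms(2) minus[OF assms(2)]] sublinear_zero[OF assms(1)] by simp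

text \<open>An infimal construction that lowers \<open>p\<close> along \<open>K\<close>. Taking
  \<open>h = - k\<close> with \<open>k\<close> in \<open>K\<close> makes its value at most
  \<open>p 0 - p k\<close>.\<close>

definition contract :: "(('a \<Rightarrow> real) \<Rightarrow> real) \<Rightarrow> ('a \<Rightarrow> real) set \<Rightarrow> ('a \<Rightarrow> real) \<Rightarrow> real" where
  "contract p K h = (INF k\<in>K. p (\<lambda>x. h x + k x) - p k)"

definition additive_cone :: "(('a \<Rightarrow> real) \<Rightarrow> real) \<Rightarrow> ('a \<Rightarrow> real) set \<Rightarrow> bool" where
  "additive_cone p K \<longleftrightarrow> K \<subseteq> L \<and> K \<noteq> {} \<and>
     (\<forall>f\<in>K. \<forall>g\<in>K. (\<lambda>x. f x + g x) \<in> K \<and> p (\<lambda>x. f x + g x) = p f + p g) \<and>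
     (\<forall>f\<in>K. \<forall>c>0. (\<lambda>x. c * f x) \<in> K)"

context
  fixes p :: "('a \<Rightarrow> real) \<Rightarrow> real" and K :: "('a \<Rightarrow> real) set"
  assumes p: "sublinear p" and cone: "additive_cone p K"
begin

lemma
  shows K: "K \<subseteq> L" "K \<noteq> {}"
    and K_add: "f \<in> K \<Longrightarrow> g \<in> K \<Longrightarrow> (\<lambda>x. f x + g x) \<in> K"
    and K_scale: "f \<in> K \<Longrightarrow> c > 0 \<Longrightarrow> (\<lambda>x. c * f x) \<in> K"
    and p_add: "f \<in> K \<Longrightarrow> g \<in> K \<Longrightarrow> p (\<lambda>x. f x + g x) = p f + p g"
  using cone by (auto simp: additive_cone_def)

lemma contract_le:
  assumes "h \<in> L" "k \<in> K"
  shows "contract p K h \<le> p (\<lambda>x. h x + k x) - p k"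
proof -
  \<comment> \<open>Subadditivity applied to \<open>k = (h + k) + (- h)\<close> bounds the family
    below, so the real infimum is a genuine one.\<close>
  have "- p (\<lambda>x. - h x) \<le> p (\<lambda>x. h x + k x) - p k" if "k \<in> K" for k
  proof -
    have "k \<in> L"
      using that K(1) by blast
    then show ?thesis
      using sublinearD(1)[OF p add[OF assms(1), of k] minus[OF assms(1)]] by simp
  qed
  then have "bdd_below ((\<lambda>k. p (\<lambda>x. h x + k x) - p k) ` K)"
    by (rule bdd_belowI2)
  then show ?thesis
    unfolding contract_def using assms(2) by (rule cINF_lower)
qed

lemma contract_greatest:
  assumes "\<And>k. k \<in> K \<Longrightarrow> c \<le> p (\<lambda>x. h x + k x) - p k"
  shows "c \<le> contract p K h"
  unfolding contract_def using K(2) assms by (rule cINF_greatest)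

lemma contract_le_self:
  assumes "h \<in> L"
  shows "contract p K h \<le> p h"
proof -
  obtain k where k: "k \<in> K"
    using K(2) by blast
  then show ?thesis
    using contract_le[OF assms k] sublinearD(1)[OF p assms, of k] K(1) by fastforce
qed

text \<open>The competitors \<open>k\<close> for \<open>f\<close> and \<open>l\<close> for
  \<open>g\<close> combine into \<open>k + l\<close> for \<open>f + g\<close>. Additivity of
  \<open>p\<close> on \<open>K\<close> makes the subtracted terms add up exactly. For homogeneity,
  \<open>k\<close> is replaced by \<open>c k\<close>.\<close>

lemma sublinear_contract: "sublinear (contract p K)"
proof (rule sublinearI)
  fix f g assume f: "f \<in> L" and g: "g \<in> L"
  have *: "contract p K (\<lambda>x. f x + g x) \<le> (p (\<lambda>x. f x + k x) - p k) + (p (\<lambda>x. g x + l x) - p l)"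
    if k: "k \<in> K" and l: "l \<in> K" for k l
  proof -
    have "contract p K (\<lambda>x. f x + g x) \<le> p (\<lambda>x. (f x + g x) + (k x + l x)) - p (\<lambda>x. k x + l x)"
      using f g k l by (intro contract_le add K_add)
    also have "(\<lambda>x. (f x + g x) + (k x + l x)) = (\<lambda>x. (f x + k x) + (g x + l x))"
      by (simp add: algebra_simps)
    also have "p \<dots> \<le> p (\<lambda>x. f x + k x) + p (\<lambda>x. g x + l x)"
      using f g k l K(1) by (intro sublinearD(1)[OF p] add) auto
    finally show ?thesis
      using p_add[OF k l] by simp
  qed
  \<comment> \<open>The bound holds for independent \<open>k\<close> and \<open>l\<close>, so the
    infima are taken one after the other, over \<open>k\<close> inside and over \<open>l\<close>
    outside.\<close>
  have "contract p K (\<lambda>x. f x + g x) - contract p K f \<le> contract p K g"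
  proof (rule contract_greatest)
    fix l assume l: "l \<in> K"
    have "contract p K (\<lambda>x. f x + g x) - (p (\<lambda>x. g x + l x) - p l) \<le> contract p K f"
      using *[OF _ l] by (intro contract_greatest) (simp add: algebra_simps)
    then show "contract p K (\<lambda>x. f x + g x) - contract p K f \<le> p (\<lambda>x. g x + l x) - p l"
      by simp
  qed
  then show "contract p K (\<lambda>x. f x + g x) \<le> contract p K f + contract p K g"
    by simp
next
  fix f :: "'a \<Rightarrow> real" and c :: real assume f: "f \<in> L" and c: "c > 0"
  have "contract p K (\<lambda>x. c * f x) / c \<le> contract p K f"
  proof (rule contract_greatest)
    fix k assume k: "k \<in> K"
    have "contract p K (\<lambda>x. c * f x) \<le> p (\<lambda>x. c * f x + c * k x) - p (\<lambda>x. c * k x)"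
      using f k c by (intro contract_le scale K_scale)
    also have "\<dots> = p (\<lambda>x. c * (f x + k x)) - p (\<lambda>x. c * k x)"
      by (simp add: distrib_left)
    also have "\<dots> = c * (p (\<lambda>x. f x + k x) - p k)"
      using f k c K(1) sublinearD(2)[OF p _ c] add[of f k] by (auto simp: right_diff_distrib)
    finally show "contract p K (\<lambda>x. c * f x) / c \<le> p (\<lambda>x. f x + k x) - p k"
      using c by (simp add: field_simps)
  qed
  then show "contract p K (\<lambda>x. c * f x) \<le> c * contract p K f"
    using c by (simp add: field_simps)
qed

end

text \<open>Infima of sublinear functionals need not be subadditive. In a chain, however, the
  smaller \<open>r\<close> of \<open>p\<close> and \<open>q\<close> gives
  \<open>r (f + g) \<le> r f + r g \<le> p f + q g\<close>, after which the two infima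
  separate.\<close>

lemma sublinear_chain_Inf:
  assumes ne: "\<C> \<noteq> {}" and sub: "\<And>p. p \<in> \<C> \<Longrightarrow> sublinear p"
    and chain: "\<And>p q. p \<in> \<C> \<Longrightarrow> q \<in> \<C> \<Longrightarrow> p \<le> q \<or> q \<le> p"
    and bdd: "\<And>f. f \<in> L \<Longrightarrow> bdd_below ((\<lambda>p. p f) ` \<C>)"
  shows "sublinear (\<lambda>f. INF p\<in>\<C>. p f)"
proof (rule sublinearI)
  fix f g assume f: "f \<in> L" and g: "g \<in> L"
  have *: "(INF p\<in>\<C>. p (\<lambda>x. f x + g x)) \<le> p f + q g" if pq: "p \<in> \<C>" "q \<in> \<C>" for p q
  proof -
    obtain r where r: "r \<in> \<C>" "r \<le> p" "r \<le> q"
      using chain[OF pq] pq by blast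
    have "(INF p\<in>\<C>. p (\<lambda>x. f x + g x)) \<le> r (\<lambda>x. f x + g x)"
      using bdd[OF add[OF f g]] r(1) by (rule cINF_lower)
    also have "\<dots> \<le> r f + r g"
      by (rule sublinearD(1)[OF sub[OF r(1)] f g])
    also have "\<dots> \<le> p f + q g"
      using r(2,3) by (intro add_mono) (auto simp: le_fun_def)
    finally show ?thesis .
  qed
  have "(INF p\<in>\<C>. p (\<lambda>x. f x + g x)) - (INF p\<in>\<C>. p f) \<le> (INF p\<in>\<C>. p g)"
  proof (rule cINF_greatest[OF ne])
    fix q assume q: "q \<in> \<C>"
    have "(INF p\<in>\<C>. p (\<lambda>x. f x + g x)) - q g \<le> (INF p\<in>\<C>. p f)"
      using *[OF _ q] by (intro cINF_greatest[OF ne]) (simp add: algebra_simps)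
    then show "(INF p\<in>\<C>. p (\<lambda>x. f x + g x)) - (INF p\<in>\<C>. p f) \<le> q g"
      by simp
  qed
  then show "(INF p\<in>\<C>. p (\<lambda>x. f x + g x)) \<le> (INF p\<in>\<C>. p f) + (INF p\<in>\<C>. p g)"
    by simp
next
  fix f :: "'a \<Rightarrow> real" and c :: real assume f: "f \<in> L" and c: "c > 0"
  have "(INF p\<in>\<C>. p (\<lambda>x. c * f x)) / c \<le> (INF p\<in>\<C>. p f)"
  proof (rule cINF_greatest[OF ne])
    fix p assume p: "p \<in> \<C>"
    have "(INF p\<in>\<C>. p (\<lambda>x. c * f x)) \<le> p (\<lambda>x. c * f x)"
      using bdd[OF scale[OF f]] p by (rule cINF_lower)
    then show "(INF p\<in>\<C>. p (\<lambda>x. c * f x)) / c \<le> p f"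
      using sublinearD(2)[OF sub[OF p] f c] c by (simp add: field_simps)
  qed
  then show "(INF p\<in>\<C>. p (\<lambda>x. c * f x)) \<le> c * (INF p\<in>\<C>. p f)"
    using c by (simp add: field_simps)
qed

lemma sublinear_cong:
  assumes "sublinear p" "\<And>f. f \<in> L \<Longrightarrow> q f = p f"
  shows "sublinear q"
  using assms by (simp add: sublinear_def subadditive_on_def pos_homogeneous_on_def add scale)

text \<open>A sublinear functional that is minimal for the pointwise order is linear: contracting it
  along a ray cannot decrease it. Values outside \<open>L\<close> are pinned to \<open>0\<close> to make the order
  antisymmetric.\<close>

theorem hahn_banach:
  assumes p: "sublinear p"
  shows "\<exists>\<phi>. linear_functional \<phi> \<and> (\<forall>f\<in>L. \<phi> f \<le> p f)"
proof -
  define S where "S = {q. sublinear q \<and> (\<forall>f\<in>L. q f \<le> p f) \<and> (\<forall>f. f \<notin> L \<longrightarrow> q f = 0)}"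
  define restr where "restr q = (\<lambda>f. if f \<in> L then q f else 0)" for q :: "('a \<Rightarrow> real) \<Rightarrow> real"
  have restr: "restr q \<in> S" if "sublinear q" "\<And>f. f \<in> L \<Longrightarrow> q f \<le> p f" for q
    using that sublinear_cong[OF that(1), of "restr q"] by (simp add: S_def restr_def)
  \<comment> \<open>Zorn for the reversed order. A nonempty chain is bounded by its pointwise
    infimum, the empty chain by \<open>p\<close> itself, both set to 0 outside
    \<open>L\<close>.\<close>
  have "\<exists>\<phi>\<in>S. \<forall>q\<in>S. q \<le> \<phi> \<longrightarrow> q = \<phi>"
  proof (rule predicate_Zorn)
    show "partial_order_on S (relation_of (\<lambda>a b. b \<le> a) S)"
      by (rule partial_order_on_relation_ofI) auto
    fix \<C> assume C: "\<C> \<in> Chains (relation_of (\<lambda>a b. b \<le> a) S)"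
    then have CS: "\<C> \<subseteq> S"
      by (rule Chains_relation_of)
    have chain: "q \<le> r \<or> r \<le> q" if "q \<in> \<C>" "r \<in> \<C>" for q r
      using C that unfolding Chains_def relation_of_def by auto
    show "\<exists>u\<in>S. \<forall>a\<in>\<C>. u \<le> a"
    proof (cases "\<C> = {}")
      case True
      then show ?thesis
        using restr[OF p] by auto
    next
      case False
      \<comment> \<open>Every \<open>q\<close> in the chain satisfies
        \<open>q f \<ge> - q (- f) \<ge> - p (- f)\<close>, a bound independent of
        \<open>q\<close>.\<close>
      have bdd: "bdd_below ((\<lambda>q. q f) ` \<C>)" if f: "f \<in> L" for f
      proof (rule bdd_belowI2)
        fix q assume "q \<in> \<C>"
        then have "sublinear q" "q (\<lambda>x. - f x) \<le> p (\<lambda>x. - f x)"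
          using CS minus[OF f] by (auto simp: S_def)
        then show "- p (\<lambda>x. - f x) \<le> q f"
          using sublinear_ge_minus[OF _ f, of q] by simp
      qed
      define u where "u f = (INF q\<in>\<C>. q f)" for f
      have u_le: "u f \<le> q f" if "q \<in> \<C>" "f \<in> L" for q f
        unfolding u_def using bdd[OF that(2)] that(1) by (rule cINF_lower)
      have "sublinear u"
        unfolding u_def using CS False chain bdd by (intro sublinear_chain_Inf) (auto simp: S_def)
      moreover have "u f \<le> p f" if f: "f \<in> L" for f
      proof -
        obtain q where "q \<in> \<C>"
          using False by blast
        then show ?thesis
          using u_le[of q f] CS f by (force simp: S_def)
      qed
      ultimately have "restr u \<in> S"
        by (rule restr)
      moreover have "restr u \<le> q" if "q \<in> \<C>" for q
        using that CS u_le by (auto simp: le_fun_def restr_def S_def)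
      ultimately show ?thesis
        by blast
    qed
  qed
  then obtain \<phi> where \<phi>S: "\<phi> \<in> S" and min: "\<And>q. q \<in> S \<Longrightarrow> q \<le> \<phi> \<Longrightarrow> q = \<phi>"
    by blast
  then have \<phi>: "sublinear \<phi>" and le: "\<And>f. f \<in> L \<Longrightarrow> \<phi> f \<le> p f" and out: "\<And>f. f \<notin> L \<Longrightarrow> \<phi> f = 0"
    by (auto simp: S_def)
  have ray: "\<phi> (\<lambda>x. t * g x) = t * \<phi> g" if "g \<in> L" "t \<ge> 0" for g t
    using that sublinearD(2)[OF \<phi>, of g t] sublinear_zero[OF \<phi>] by (cases "t = 0") auto
  have additive: "\<phi> (\<lambda>x. f x + g x) = \<phi> f + \<phi> g" if f: "f \<in> L" and g: "g \<in> L" for f g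
  proof (rule antisym[OF sublinearD(1)[OF \<phi> f g]])
    \<comment> \<open>Contract along the ray through \<open>g\<close>. By minimality the contraction
      equals \<open>\<phi>\<close> on \<open>L\<close>, and its defining bound at
      \<open>k = g\<close> reads \<open>\<phi> f \<le> \<phi> (f + g) - \<phi> g\<close>.\<close>
    define K where "K = {\<lambda>x. t * g x | t. t \<ge> 0}"
    have K: "K \<subseteq> L" "K \<noteq> {}"
      using scale[OF g] by (auto simp: K_def intro: exI[of _ 0])
    have K_scale: "(\<lambda>x. c * k x) \<in> K" if k: "k \<in> K" and c: "c > 0" for k c
    proof -
      obtain t where t: "k = (\<lambda>x. t * g x)" "t \<ge> 0"
        using k by (auto simp: K_def)
      then have "(\<lambda>x. c * k x) = (\<lambda>x. (c * t) * g x)" "c * t \<ge> 0"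
        using c by auto
      then show ?thesis
        unfolding K_def by blast
    qed
    have K_add: "(\<lambda>x. k x + l x) \<in> K \<and> \<phi> (\<lambda>x. k x + l x) = \<phi> k + \<phi> l"
      if kl: "k \<in> K" "l \<in> K" for k l
    proof -
      obtain s t where st: "k = (\<lambda>x. s * g x)" "l = (\<lambda>x. t * g x)" "s \<ge> 0" "t \<ge> 0"
        using kl by (auto simp: K_def)
      have eq: "(\<lambda>x. k x + l x) = (\<lambda>x. (s + t) * g x)"
        by (simp add: st distrib_right)
      have mem: "(\<lambda>x. k x + l x) \<in> K"
        unfolding K_def eq using st(3,4) by (intro CollectI exI[of _ "s + t"]) simp
      have "\<phi> (\<lambda>x. k x + l x) = (s + t) * \<phi> g"
        unfolding eq using st(3,4) by (intro ray g) simp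
      also have "\<dots> = \<phi> k + \<phi> l"
        using ray[OF g st(3)] ray[OF g st(4)] by (simp add: st(1,2) distrib_right)
      finally have "\<phi> (\<lambda>x. k x + l x) = \<phi> k + \<phi> l" .
      with mem show ?thesis
        by simp
    qed
    have "additive_cone \<phi> K"
      using K K_add K_scale by (simp add: additive_cone_def)
    note contr = \<phi> this
    let ?q = "contract \<phi> K"
    have "?q h \<le> \<phi> h" if "h \<in> L" for h
      using that by (rule contract_le_self[OF contr])
    moreover have "sublinear ?q"
      by (rule sublinear_contract[OF contr])
    ultimately have "restr ?q \<in> S" "restr ?q \<le> \<phi>"
      using le out restr[of ?q] order_trans[OF _ le] by (auto simp: le_fun_def restr_def)
    then have "restr ?q = \<phi>"
      by (rule min)
    then have "?q f = \<phi> f"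
      using f by (auto simp: restr_def dest: fun_cong[of _ _ f])
    moreover have "g \<in> K"
      unfolding K_def by (intro CollectI exI[of _ 1]) simp
    ultimately show "\<phi> f + \<phi> g \<le> \<phi> (\<lambda>x. f x + g x)"
      using contract_le[OF contr f, of g] by simp
  qed
  have neg: "\<phi> (\<lambda>x. - f x) = - \<phi> f" if f: "f \<in> L" for f
    using additive[OF f minus[OF f]] sublinear_zero[OF \<phi>] by simp
  have "\<phi> (\<lambda>x. c * f x) = c * \<phi> f" if f: "f \<in> L" for f c
  proof (cases "c \<ge> 0")
    case True
    then show ?thesis
      by (rule ray[OF f])
  next
    case False
    then show ?thesis
      using ray[OF minus[OF f], of "- c"] neg[OF f] by simp
  qed
  with le additive show ?thesis
    unfolding linear_functional_def by blast
qed

text \<open>Apply Hahn-Banach to the contraction instead of \<open>p\<close>. For \<open>f\<close>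
  in \<open>K\<close> the contraction at \<open>- f\<close> is at most \<open>- p f\<close>, and
  linearity turns this into \<open>\<phi> f \<ge> p f\<close>.\<close>

corollary hahn_banach_on_cone:
  assumes p: "sublinear p" and cone: "additive_cone p K"
  shows "\<exists>\<phi>. linear_functional \<phi> \<and> (\<forall>f\<in>L. \<phi> f \<le> p f) \<and> (\<forall>f\<in>K. \<phi> f = p f)"
proof -
  note contr = p cone
  have "sublinear (contract p K)"
    by (rule sublinear_contract[OF contr])
  from hahn_banach[OF this]
  obtain \<phi> where \<phi>: "linear_functional \<phi>" and le: "\<And>f. f \<in> L \<Longrightarrow> \<phi> f \<le> contract p K f"
    by blast
  have le_p: "\<phi> f \<le> p f" if "f \<in> L" for f
    using le[OF that] contract_le_self[OF contr that] by linarith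
  moreover have "\<phi> f = p f" if f: "f \<in> K" for f
  proof -
    have fL: "f \<in> L"
      using f K(1)[OF contr] by blast
    have "\<phi> (\<lambda>x. - f x) \<le> p (\<lambda>x. - f x + f x) - p f"
      by (rule order_trans[OF le[OF minus[OF fL]] contract_le[OF contr minus[OF fL] f]])
    then show ?thesis
      using linear_minus[OF \<phi> fL] sublinear_zero[OF p] le_p[OF fL] by simp
  qed
  ultimately show ?thesis
    using \<phi> by blast
qed

end

section \<open>The integral part of a positive functional\<close>

locale positive_functional = function_subspace +
  fixes \<phi> :: "('a \<Rightarrow> real) \<Rightarrow> real"
  assumes bounded_mem: "(\<And>x. \<bar>f x\<bar> \<le> c) \<Longrightarrow> f \<in> L"
    and abs_mem: "f \<in> L \<Longrightarrow> (\<lambda>x. \<bar>f x\<bar>) \<in> L"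
    and linear: "linear_functional \<phi>"
    and pos: "f \<in> L \<Longrightarrow> (\<And>x. f x \<ge> 0) \<Longrightarrow> \<phi> f \<ge> 0"
begin

lemma mono: "f \<in> L \<Longrightarrow> g \<in> L \<Longrightarrow> (\<And>x. f x \<le> g x) \<Longrightarrow> \<phi> f \<le> \<phi> g"
  using pos[of "\<lambda>x. g x - f x"] diff[of g f] linear_diff[OF linear, of g f] by simp

lemma abs_le: "f \<in> L \<Longrightarrow> \<bar>\<phi> f\<bar> \<le> \<phi> (\<lambda>x. \<bar>f x\<bar>)"
  using mono[OF _ abs_mem, of f f] mono[OF minus abs_mem, of f f] linear_minus[OF linear, of f]
  by (simp add: abs_le_iff)

definition \<mu> :: "'a set \<Rightarrow> real" where
  "\<mu> A = \<phi> (indicator A)"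

lemma indicator_mem: "indicator A \<in> L"
  by (rule bounded_mem[of _ 1]) (simp add: indicator_def)

lemma const_mem: "(\<lambda>_. c) \<in> L"
  by (rule bounded_mem[of _ "\<bar>c\<bar>"]) simp

lemma simple_mem: "simple_fn f \<Longrightarrow> f \<in> L"
  using bounded_mem by (metis simple_fn_bounded)

lemma trunc_mem: "trunc_fn n f \<in> L"
  by (rule bounded_mem[of _ "real n"]) (rule trunc_fn_bound)

lemma const_eq: "\<phi> (\<lambda>_. c) = c * \<mu> UNIV"
  using linearD(2)[OF linear indicator_mem, of c UNIV] by (simp add: \<mu>_def)

sublocale \<mu>: fin_additive \<mu>
proof
  show "\<mu> A \<ge> 0" for A
    unfolding \<mu>_def by (rule pos[OF indicator_mem]) simp
  show "\<mu> (A \<union> B) = \<mu> A + \<mu> B" if "A \<inter> B = {}" for A B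
  proof -
    have "indicator (A \<union> B) = (\<lambda>x. indicator A x + indicator B x :: real)"
      using that by (auto simp: indicator_def fun_eq_iff)
    then show ?thesis
      unfolding \<mu>_def using linearD(1)[OF linear indicator_mem indicator_mem] by simp
  qed
qed

lemma simple_int_eq:
  assumes "simple_fn f"
  shows "simple_int \<mu> f = \<phi> f"
proof -
  have "f = (\<lambda>x. \<Sum>v\<in>range f. v * indicator (f -` {v}) x)"
  proof
    fix x
    have "(\<Sum>v\<in>range f. v * indicator (f -` {v}) x) = (\<Sum>v\<in>range f. if v = f x then v else 0)"
      by (intro sum.cong) (auto simp: indicator_def)
    then show "f x = (\<Sum>v\<in>range f. v * indicator (f -` {v}) x)"
      using assms by (simp add: simple_fn_def)
  qed
  then have "\<phi> f = \<phi> (\<lambda>x. \<Sum>v\<in>range f. v * indicator (f -` {v}) x)"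
    by simp
  also have "\<dots> = (\<Sum>v\<in>range f. \<phi> (\<lambda>x. v * indicator (f -` {v}) x))"
    by (intro linear_sum[OF linear] scale indicator_mem)
  also have "\<dots> = simple_int \<mu> f"
    by (simp add: simple_int_def \<mu>_def linearD(2)[OF linear indicator_mem])
  finally show ?thesis
    by simp
qed

text \<open>Truncating before rounding keeps the range finite even when \<open>f\<close> is
  unbounded.\<close>

definition approx :: "('a \<Rightarrow> real) \<Rightarrow> nat \<Rightarrow> 'a \<Rightarrow> real" where
  "approx f n = step_approx n (trunc_fn n f)"

lemma simple_approx: "simple_fn (approx f n)"
  unfolding approx_def by (rule simple_fn_step_approx[OF trunc_fn_bound])

lemma approx_close: "\<bar>approx f n x - trunc_fn n f x\<bar> \<le> (1/2) ^ n"
  unfolding approx_def by (rule step_approx_close)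

text \<open>Markov's inequality, from \<open>n\<close> times the indicator of the tail being at most
  \<open>\<bar>f\<bar>\<close>.\<close>

lemma tail_le:
  assumes "f \<in> L" "n > 0"
  shows "\<mu> {x. \<bar>f x\<bar> > real n} \<le> \<phi> (\<lambda>x. \<bar>f x\<bar>) / real n"
proof -
  have "real n * \<mu> {x. \<bar>f x\<bar> > real n} = \<phi> (\<lambda>x. real n * indicator {x. \<bar>f x\<bar> > real n} x)"
    by (simp add: \<mu>_def linearD(2)[OF linear indicator_mem])
  also have "\<dots> \<le> \<phi> (\<lambda>x. \<bar>f x\<bar>)"
    by (intro mono scale indicator_mem abs_mem assms) (auto simp: indicator_def)
  finally show ?thesis
    using assms(2) by (simp add: field_simps)
qed

lemma approx_conv_in_measure:
  assumes f: "f \<in> L"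
  shows "conv_in_measure \<mu> (approx f) f"
  unfolding conv_in_measure_def
proof (intro allI impI)
  fix e :: real assume e: "e > 0"
  show "(\<lambda>n. \<mu> {x. \<bar>approx f n x - f x\<bar> > e}) \<longlonglongrightarrow> 0"
  proof (rule tendsto_sandwich[OF _ _ tendsto_const])
    show "(\<lambda>n. \<phi> (\<lambda>x. \<bar>f x\<bar>) / real n) \<longlonglongrightarrow> 0"
      by (rule lim_const_over_n)
    have "(\<lambda>n. (1/2) ^ n :: real) \<longlonglongrightarrow> 0"
      by (rule LIMSEQ_power_zero) simp
    then have "\<forall>\<^sub>F n in sequentially. (1/2) ^ n < e"
      using e by (rule order_tendstoD)
    then show "\<forall>\<^sub>F n in sequentially. \<mu> {x. \<bar>approx f n x - f x\<bar> > e} \<le> \<phi> (\<lambda>x. \<bar>f x\<bar>) / real n"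
      using eventually_gt_at_top[of 0]
    proof eventually_elim
      case (elim n)
      \<comment> \<open>The rounding error is already below \<open>e\<close>, so a larger deviation
        can only come from truncation, that is from the tail.\<close>
      have "{x. \<bar>approx f n x - f x\<bar> > e} \<subseteq> {x. \<bar>f x\<bar> > real n}"
      proof (rule subsetI, rule CollectI, rule ccontr)
        fix x assume x: "x \<in> {x. \<bar>approx f n x - f x\<bar> > e}" "\<not> real n < \<bar>f x\<bar>"
        then have "trunc_fn n f x = f x"
          by (intro trunc_fn_eq) simp
        then show False
          using approx_close[of f n x] x(1) elim(1) by simp
      qed
      then show ?case
        using \<mu>.mono tail_le[OF f elim(2)] order_trans by blast
    qed
  qed (simp add: \<mu>.nonneg)
qed

text \<open>For \<open>n \<le> k\<close> the distance between the two truncations of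
  \<open>f\<close> is exactly the increment of the truncations of \<open>\<bar>f\<bar>\<close>. The
  distance in mean is therefore bounded by an increment of a monotone real sequence, plus two
  rounding errors.\<close>

lemma approx_mean_diff_le:
  assumes f: "f \<in> L" and nk: "n \<le> k"
  shows "simple_int \<mu> (\<lambda>x. \<bar>approx f n x - approx f k x\<bar>)
    \<le> \<phi> (trunc_fn k (\<lambda>x. \<bar>f x\<bar>)) - \<phi> (trunc_fn n (\<lambda>x. \<bar>f x\<bar>)) + ((1/2) ^ n + (1/2) ^ k) * \<mu> UNIV"
proof -
  let ?t = "\<lambda>n. trunc_fn n (\<lambda>x. \<bar>f x\<bar>)"
  have s: "simple_fn (\<lambda>x. \<bar>approx f n x - approx f k x\<bar>)"
    by (rule simple_fn_comp2[OF simple_approx simple_approx])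
  have d: "(\<lambda>x. ?t k x - ?t n x) \<in> L"
    by (intro diff trunc_mem)
  have "simple_int \<mu> (\<lambda>x. \<bar>approx f n x - approx f k x\<bar>) = \<phi> (\<lambda>x. \<bar>approx f n x - approx f k x\<bar>)"
    by (rule simple_int_eq[OF s])
  also have "\<dots> \<le> \<phi> (\<lambda>x. (?t k x - ?t n x) + ((1/2) ^ n + (1/2) ^ k))"
  proof (rule mono[OF simple_mem[OF s] add[OF d const_mem]])
    fix x
    have "\<bar>trunc_fn n f x - trunc_fn k f x\<bar> = ?t k x - ?t n x"
      using nk by (auto simp: trunc_fn_clamp max_def min_def)
    then show "\<bar>approx f n x - approx f k x\<bar> \<le> (?t k x - ?t n x) + ((1/2) ^ n + (1/2) ^ k)"
      using approx_close[of f n x] approx_close[of f k x] by linarith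
  qed
  also have "\<dots> = \<phi> (?t k) - \<phi> (?t n) + ((1/2) ^ n + (1/2) ^ k) * \<mu> UNIV"
    by (simp add: linearD(1)[OF linear d const_mem] linear_diff[OF linear trunc_mem trunc_mem] const_eq)
  finally show ?thesis .
qed

text \<open>The truncations of \<open>\<bar>f\<bar>\<close> have increasing \<open>\<phi>\<close>-values bounded by \<open>\<phi> \<bar>f\<bar>\<close>;
  this monotone convergence makes the approximations Cauchy in mean.\<close>

lemma ds_approx_approx:
  assumes f: "f \<in> L"
  shows "ds_approx \<mu> (approx f) f"
  unfolding ds_approx_def
proof (intro conjI allI impI simple_approx approx_conv_in_measure[OF f])
  fix e :: real assume "e > 0"
  then have e: "e / 4 > 0"
    by simp
  define a where "a n = \<phi> (trunc_fn n (\<lambda>x. \<bar>f x\<bar>))" for n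
  have "incseq a"
    unfolding a_def
    by (intro incseq_SucI mono trunc_mem) (auto simp: trunc_fn_clamp max_def min_def)
  moreover have "a n \<le> \<phi> (\<lambda>x. \<bar>f x\<bar>)" for n
    unfolding a_def
    by (intro mono trunc_mem abs_mem f) (auto simp: trunc_fn_clamp max_def min_def)
  ultimately have "convergent a"
    using incseq_convergent[of a] convergentI by metis
  then have "Cauchy a"
    by (rule convergent_Cauchy)
  then obtain N1 where N1: "\<And>n k. n \<ge> N1 \<Longrightarrow> k \<ge> N1 \<Longrightarrow> \<bar>a n - a k\<bar> < e / 4"
    using e unfolding Cauchy_def dist_real_def by blast
  have "(\<lambda>n. (1/2) ^ n * \<mu> UNIV) \<longlonglongrightarrow> 0"
    by (intro tendsto_mult_left_zero LIMSEQ_power_zero) simp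
  from order_tendstoD(2)[OF this e]
  obtain N2 where N2: "\<And>n. n \<ge> N2 \<Longrightarrow> (1/2) ^ n * \<mu> UNIV < e / 4"
    unfolding eventually_sequentially by blast
  have *: "simple_int \<mu> (\<lambda>x. \<bar>approx f n x - approx f k x\<bar>) < e"
    if "n \<ge> max N1 N2" "n \<le> k" for n k
  proof -
    have "\<bar>a k - a n\<bar> < e / 4" "(1/2) ^ n * \<mu> UNIV < e / 4" "(1/2) ^ k * \<mu> UNIV < e / 4"
      using that by (intro N1 N2; simp)+
    then show ?thesis
      using approx_mean_diff_le[OF f that(2)] e unfolding a_def distrib_right by linarith
  qed
  have "simple_int \<mu> (\<lambda>x. \<bar>approx f n x - approx f k x\<bar>) < e"
    if "n \<ge> max N1 N2" "k \<ge> max N1 N2" for n k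
    using *[of n k] *[of k n] that by (cases "n \<le> k") (simp_all add: abs_minus_commute)
  then show "\<exists>N. \<forall>n\<ge>N. \<forall>k\<ge>N. simple_int \<mu> (\<lambda>x. \<bar>approx f n x - approx f k x\<bar>) < e"
    by blast
qed

lemma subset_L1: "L \<subseteq> L1 \<mu>"
  using ds_approx_approx by (auto simp: L1_def)

text \<open>Once \<open>n\<close> exceeds the bound, truncation changes nothing and
  \<open>approx g n\<close> converges uniformly to \<open>g\<close>; positivity makes
  \<open>\<phi>\<close> continuous for uniform convergence.\<close>

lemma ds_integral_bounded:
  assumes b: "\<And>x. \<bar>g x\<bar> \<le> c"
  shows "ds_integral \<mu> g = \<phi> g"
proof (rule \<mu>.ds_integral_eq)
  have g: "g \<in> L"
    using b by (rule bounded_mem)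
  then show "ds_approx \<mu> (approx g) g"
    by (rule ds_approx_approx)
  have lim: "(\<lambda>n. (1/2) ^ n * \<mu> UNIV) \<longlonglongrightarrow> 0"
    by (intro tendsto_mult_left_zero LIMSEQ_power_zero) simp
  have "(\<lambda>n. simple_int \<mu> (approx g n) - \<phi> g) \<longlonglongrightarrow> 0"
  proof (rule Lim_null_comparison[OF _ lim])
    show "\<forall>\<^sub>F n in sequentially. norm (simple_int \<mu> (approx g n) - \<phi> g) \<le> (1/2) ^ n * \<mu> UNIV"
      using eventually_ge_at_top[of "nat \<lceil>c\<rceil>"]
    proof eventually_elim
      case (elim n)
      have a: "approx g n \<in> L"
        by (rule simple_mem[OF simple_approx])
      have "norm (simple_int \<mu> (approx g n) - \<phi> g) = \<bar>\<phi> (\<lambda>x. approx g n x - g x)\<bar>"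
        by (simp add: simple_int_eq[OF simple_approx] linear_diff[OF linear a g])
      also have "\<dots> \<le> \<phi> (\<lambda>x. \<bar>approx g n x - g x\<bar>)"
        by (rule abs_le[OF diff[OF a g]])
      also have "\<dots> \<le> \<phi> (\<lambda>_. (1/2) ^ n)"
      proof (rule mono[OF abs_mem[OF diff[OF a g]] const_mem])
        fix x
        have "\<bar>g x\<bar> \<le> real n"
          using b[of x] elim by (simp add: nat_ceiling_le_eq)
        then show "\<bar>approx g n x - g x\<bar> \<le> (1/2) ^ n"
          using approx_close[of g n x] by (simp add: trunc_fn_eq)
      qed
      finally show ?case
        by (simp add: const_eq)
    qed
  qed
  then show "(\<lambda>n. simple_int \<mu> (approx g n)) \<longlonglongrightarrow> \<phi> g"
    by (simp add: LIM_zero_iff)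
qed

text \<open>Truncations are bounded, so \<open>\<phi>\<close> integrates them exactly. The integral
  is thus the part of \<open>\<phi>\<close> that is recovered from bounded functions.\<close>

lemma trunc_tendsto:
  assumes "f \<in> L"
  shows "(\<lambda>n. \<phi> (trunc_fn n f)) \<longlonglongrightarrow> ds_integral \<mu> f"
  using \<mu>.ds_integral_trunc_tendsto[of f] subset_L1 assms
  by (auto simp: ds_integral_bounded[OF trunc_fn_bound])

lemma ds_integral_le:
  assumes "f \<in> L" "\<And>x. f x \<ge> 0"
  shows "ds_integral \<mu> f \<le> \<phi> f"
proof (rule tendsto_upperbound[OF trunc_tendsto[OF assms(1)]])
  have "\<phi> (trunc_fn n f) \<le> \<phi> f" for n
  proof (intro mono trunc_mem assms)
    show "trunc_fn n f x \<le> f x" for x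
      using assms(2)[of x] by (auto simp: trunc_fn_clamp max_def min_def)
  qed
  then show "\<forall>\<^sub>F n in sequentially. \<phi> (trunc_fn n f) \<le> \<phi> f"
    by simp
qed simp

lemma positive_linear_on_singular_part:
  "positive_linear_on L (\<lambda>f. \<phi> f - ds_integral \<mu> f)"
  using subset_L1 ds_integral_le
  by (auto simp: positive_linear_on_def \<mu>.L1_add(2) \<mu>.L1_scale linearD[OF linear] subset_eq
      right_diff_distrib)

end

section \<open>Star orders\<close>

locale star_ordering =
  fixes ge :: "('a \<Rightarrow> real) \<Rightarrow> ('a \<Rightarrow> real) \<Rightarrow> bool"
  assumes star_order: "star_order ge"
begin

lemma order_rules:
  shows "ge f f" "ge f g \<Longrightarrow> ge g h \<Longrightarrow> ge f h"
    and "(\<And>x. f x \<ge> 0) \<Longrightarrow> ge f (\<lambda>_. 0)"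
    and "ge f (\<lambda>_. 0) \<Longrightarrow> ge (\<lambda>x. f x * indicator A x) (\<lambda>_. 0)"
    and "ge f g \<Longrightarrow> ge f' g' \<Longrightarrow> a \<ge> 0 \<Longrightarrow> b \<ge> 0 \<Longrightarrow>
      ge (\<lambda>x. a * f x + b * f' x) (\<lambda>x. a * g x + b * g' x)"
  using star_order unfolding star_order_def by blast+

lemma ge_add:
  assumes "ge f g"
  shows "ge (\<lambda>x. f x + h x) (\<lambda>x. g x + h x)"
  using order_rules(5)[OF assms order_rules(1), of 1 1 h] by simp

text \<open>Adding a reflexive pair moves functions across the relation. This reduces comparisons to
  comparisons with 0, the form in which (CERT) and (REST) are stated.\<close>

lemma ge_iff_diff: "ge f g \<longleftrightarrow> ge (\<lambda>x. f x - g x) (\<lambda>_. 0)"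
  using ge_add[of f g "\<lambda>x. - g x"] ge_add[of "\<lambda>x. f x - g x" "\<lambda>_. 0" g]
  by auto

lemma ge_of_le:
  assumes "\<And>x. g x \<le> f x"
  shows "ge f g"
  using order_rules(3)[of "\<lambda>x. f x - g x"] assms ge_iff_diff by simp

lemma bounded_starI:
  assumes "\<And>x. \<bar>f x\<bar> \<le> c"
  shows "f \<in> bounded_star ge"
proof -
  have "ge (\<lambda>_. \<bar>c\<bar> + 1) (\<lambda>x. \<bar>f x\<bar>)"
  proof (rule ge_of_le)
    show "\<bar>f x\<bar> \<le> \<bar>c\<bar> + 1" for x
      using assms[of x] by linarith
  qed
  then show ?thesis
    unfolding bounded_star_def by (intro CollectI exI[of _ "\<bar>c\<bar> + 1"]) auto
qed

text \<open>On \<open>A = {\<bar>f\<bar> > c}\<close> with \<open>c \<ge> 2 \<eta>\<close>, the hypothesis restricts to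
  \<open>\<eta> 1\<^sub>A \<ge>\<^sub>* \<bar>f\<bar> 1\<^sub>A \<ge> 2 \<eta> 1\<^sub>A\<close>, whence \<open>\<bar>f\<bar> 1\<^sub>A\<close> is negligible.\<close>

lemma bounded_star_tail_null:
  assumes f: "ge (\<lambda>_. \<eta>) (\<lambda>x. \<bar>f x\<bar>)" and n: "c \<ge> 2 * \<eta>"
  shows "ge (\<lambda>_. 0) (\<lambda>x. \<bar>f x\<bar> * indicator {x. \<bar>f x\<bar> > c} x)"
proof -
  let ?A = "{x. \<bar>f x\<bar> > c}"
  have "ge (\<lambda>x. (\<eta> - \<bar>f x\<bar>) * indicator ?A x) (\<lambda>_. 0)"
    using f ge_iff_diff by (intro order_rules(4)) simp
  from order_rules(5)[OF this order_rules(1), of 2 0 "\<lambda>_. 0"]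
  have "ge (\<lambda>x. 2 * ((\<eta> - \<bar>f x\<bar>) * indicator ?A x)) (\<lambda>_. 0)"
    by simp
  \<comment> \<open>On the tail \<open>2 * \<eta> \<le> c < \<bar>f\<bar>\<close>, hence
    \<open>2 * (\<eta> - \<bar>f\<bar>) \<le> - \<bar>f\<bar>\<close>; off the tail both sides are
    0.\<close>
  moreover have "ge (\<lambda>x. - (\<bar>f x\<bar> * indicator ?A x)) (\<lambda>x. 2 * ((\<eta> - \<bar>f x\<bar>) * indicator ?A x))"
    using n by (intro ge_of_le) (auto simp: indicator_def)
  ultimately have "ge (\<lambda>x. - (\<bar>f x\<bar> * indicator ?A x)) (\<lambda>_. 0)"
    using order_rules(2) by blast
  then show ?thesis
    using ge_iff_diff[of "\<lambda>_. 0"] by simp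
qed

text \<open>The error of a truncation at level \<open>n\<close> is dominated by the tail of
  \<open>\<bar>f\<bar>\<close> above \<open>n\<close>. For \<open>n \<ge> 2 * \<eta>\<close> that
  tail is negligible and \<open>\<phi>\<close> is at most 0 on it, so the values of
  \<open>\<phi>\<close> on truncations are eventually constant.\<close>

lemma ds_integral_eq_of_bounded_star:
  assumes "positive_functional L \<phi>"
    and star_mono: "\<And>f g. f \<in> L \<Longrightarrow> g \<in> L \<Longrightarrow> ge f g \<Longrightarrow> \<phi> g \<le> \<phi> f"
    and fL: "f \<in> L" and f: "f \<in> bounded_star ge"
  shows "ds_integral (positive_functional.\<mu> \<phi>) f = \<phi> f"
proof -
  interpret positive_functional L \<phi>
    by fact
  obtain \<eta> where \<eta>: "ge (\<lambda>_. \<eta>) (\<lambda>x. \<bar>f x\<bar>)"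
    using f by (auto simp: bounded_star_def)
  have eq: "\<phi> (trunc_fn n f) = \<phi> f" if n: "n \<ge> nat \<lceil>2 * \<eta>\<rceil>" for n
  proof -
    let ?h = "\<lambda>x. \<bar>f x\<bar> * indicator {x. \<bar>f x\<bar> > real n} x"
    \<comment> \<open>\<open>L\<close> is not assumed closed under multiplication by indicators. The
      part of \<open>f\<close> below the level is bounded, hence in \<open>L\<close>, and the tail
      is the modulus of \<open>f\<close> minus that part.\<close>
    have "?h = (\<lambda>x. \<bar>f x - trunc_fn n f x * indicator {x. \<bar>f x\<bar> \<le> real n} x\<bar>)"
      by (auto simp: trunc_fn_eq indicator_def)
    moreover have "(\<lambda>x. trunc_fn n f x * indicator {x. \<bar>f x\<bar> \<le> real n} x) \<in> L"
      by (rule bounded_mem[of _ "real n"]) (use trunc_fn_bound in \<open>auto simp: indicator_def\<close>)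
    ultimately have h: "?h \<in> L"
      using abs_mem[OF diff[OF fL]] by simp
    have "ge (\<lambda>_. 0) ?h"
      using n by (intro bounded_star_tail_null[OF \<eta>]) (simp add: nat_ceiling_le_eq)
    then have "\<phi> ?h \<le> 0"
      using star_mono[OF zero h] linear_zero[OF linear] by simp
    moreover have "\<bar>\<phi> (\<lambda>x. f x - trunc_fn n f x)\<bar> \<le> \<phi> ?h"
    proof (rule order_trans[OF abs_le[OF diff[OF fL trunc_mem]]])
      show "\<phi> (\<lambda>x. \<bar>f x - trunc_fn n f x\<bar>) \<le> \<phi> ?h"
      proof (rule mono[OF abs_mem[OF diff[OF fL trunc_mem]] h])
        show "\<bar>f x - trunc_fn n f x\<bar> \<le> ?h x" for x
          by (auto simp: trunc_fn_clamp max_def min_def indicator_def)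
      qed
    qed
    ultimately show ?thesis
      using linear_diff[OF linear fL trunc_mem] by simp
  qed
  have "(\<lambda>n. \<phi> (trunc_fn n f)) \<longlonglongrightarrow> \<phi> f"
    by (rule tendsto_eventually) (use eq eventually_sequentially in blast)
  then show ?thesis
    using LIMSEQ_unique trunc_tendsto[OF fL] by blast
qed

end

section \<open>Decomposition of the sublinear functional\<close>

lemma function_subspace_vector_lattice: "vector_lattice L \<Longrightarrow> function_subspace L"
  unfolding vector_lattice_def by unfold_locales auto

lemma vector_lattice_abs:
  assumes "vector_lattice L" "f \<in> L"
  shows "(\<lambda>x. \<bar>f x\<bar>) \<in> L"
proof -
  interpret function_subspace L
    by (rule function_subspace_vector_lattice[OF assms(1)])
  have "(\<lambda>x. max (f x) (- f x)) \<in> L"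
    using assms minus[OF assms(2)] unfolding vector_lattice_def by simp
  moreover have "(\<lambda>x. max (f x) (- f x)) = (\<lambda>x. \<bar>f x\<bar>)"
    by (auto simp: max_def)
  ultimately show ?thesis
    by simp
qed

context function_subspace
begin

text \<open>Two cone elements \<open>s u\<close> and \<open>t v\<close> are rescaled to the common
  factor \<open>s + t\<close>. The rescaled functions and their sum all lie in \<open>C\<close>, so
  homogeneity carries additivity from \<open>C\<close> to the cone.\<close>

lemma hahn_banach_additive_on_convex:
  assumes \<gamma>: "sublinear \<gamma>" and C: "C \<subseteq> L" "convex_fn_set C" "(\<lambda>_. 0) \<in> C"
    and additive: "\<And>f g. f \<in> C \<Longrightarrow> g \<in> C \<Longrightarrow> \<gamma> (\<lambda>x. f x + g x) = \<gamma> f + \<gamma> g"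
  shows "\<exists>\<phi>. linear_functional \<phi> \<and> (\<forall>f\<in>L. \<phi> f \<le> \<gamma> f) \<and> (\<forall>f\<in>C. \<phi> f = \<gamma> f)"
proof -
  define K where "K = {\<lambda>x. t * f x | t f. t > 0 \<and> f \<in> C}"
  \<comment> \<open>A convex combination of \<open>f\<close> with the origin.\<close>
  have shrink: "(\<lambda>x. t * f x) \<in> C" if "f \<in> C" "0 \<le> t" "t \<le> 1" for f t
    using C(2,3) that unfolding convex_fn_set_def by fastforce
  have K_mem: "(\<lambda>x. t * f x) \<in> K" if "f \<in> C" "t > 0" for t f
    using that unfolding K_def by blast
  have CK: "C \<subseteq> K"
    using K_mem[of _ 1] by auto
  have K_scale: "(\<lambda>x. c * f x) \<in> K" if f: "f \<in> K" and c: "c > 0" for f c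
  proof -
    obtain t g where "f = (\<lambda>x. t * g x)" "t > 0" "g \<in> C"
      using f unfolding K_def by blast
    then show ?thesis
      using K_mem[of g "c * t"] c by (simp add: mult.assoc)
  qed
  have K_add: "(\<lambda>x. f x + g x) \<in> K \<and> \<gamma> (\<lambda>x. f x + g x) = \<gamma> f + \<gamma> g" if fg: "f \<in> K" "g \<in> K" for f g
  proof -
    obtain s t u v where f: "f = (\<lambda>x. s * u x)" "s > 0" "u \<in> C"
      and g: "g = (\<lambda>x. t * v x)" "t > 0" "v \<in> C"
      using fg unfolding K_def by blast
    let ?r = "s + t"
    define u' where "u' = (\<lambda>x. (s / ?r) * u x)"
    define v' where "v' = (\<lambda>x. (t / ?r) * v x)"
    have r: "?r > 0"
      using f g by simp
    have u': "u' \<in> C" and v': "v' \<in> C"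
      unfolding u'_def v'_def using f g r by (intro shrink; simp)+
    have f': "f = (\<lambda>x. ?r * u' x)" and g': "g = (\<lambda>x. ?r * v' x)"
      using r by (auto simp: f(1) g(1) u'_def v'_def)
    \<comment> \<open>The weights \<open>s / (s + t)\<close> and \<open>t / (s + t)\<close> sum to
      1, so \<open>u' + v'\<close> is itself a convex combination of \<open>u\<close> and
      \<open>v\<close>.\<close>
    have "(\<lambda>x. (s / ?r) * u x + (1 - s / ?r) * v x) \<in> C"
      using f g r by (intro C(2)[unfolded convex_fn_set_def, rule_format]) auto
    moreover have "1 - s / ?r = t / ?r"
      using r by (simp add: field_simps)
    ultimately have w: "(\<lambda>x. u' x + v' x) \<in> C"
      by (simp add: u'_def v'_def)
    have sum_eq: "(\<lambda>x. f x + g x) = (\<lambda>x. ?r * (u' x + v' x))"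
      by (simp add: f' g' distrib_left)
    have \<gamma>r: "\<gamma> (\<lambda>x. ?r * h x) = ?r * \<gamma> h" if "h \<in> C" for h
      using that C(1) by (intro sublinearD(2)[OF \<gamma> _ r]) auto
    have "\<gamma> (\<lambda>x. f x + g x) = ?r * (\<gamma> u' + \<gamma> v')"
      unfolding sum_eq using \<gamma>r[OF w] additive[OF u' v'] by simp
    also have "\<dots> = \<gamma> f + \<gamma> g"
      using \<gamma>r[OF u'] \<gamma>r[OF v'] f' g' by (simp add: distrib_left)
    finally show ?thesis
      using K_mem[OF w r] by (simp add: sum_eq)
  qed
  have "K \<subseteq> L" "K \<noteq> {}"
    using C(1,3) CK scale unfolding K_def by blast+
  then have "additive_cone \<gamma> K"
    using K_add K_scale by (simp add: additive_cone_def)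
  from hahn_banach_on_cone[OF \<gamma> this] show ?thesis
    using CK by blast
qed

end

lemma decomposition_exists:
  assumes ge: "star_order ge" and L: "vector_lattice L" and BL: "bounded_star ge \<subseteq> L"
    and C: "C \<subseteq> L" "convex_fn_set C" "(\<lambda>_. 0) \<in> C"
    and mono: "star_monotone_on ge L \<gamma>"
    and sub: "subadditive_on L \<gamma>" and hom: "pos_homogeneous_on L \<gamma>"
    and additive: "\<And>f g. f \<in> C \<Longrightarrow> g \<in> C \<Longrightarrow> \<gamma> (\<lambda>x. f x + g x) = \<gamma> f + \<gamma> g"
  shows "\<exists>\<beta> m. positive_linear_on L \<beta> \<and> (\<forall>f\<in>bounded_star ge. \<beta> f = 0) \<and>
       m \<in> ba_star_plus ge \<and> L \<subseteq> L1 m \<and>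
       (\<forall>h\<in>L. ereal (\<gamma> h) \<ge> ereal (\<beta> h) + integral_star m h) \<and>
       (\<forall>f\<in>C. ereal (\<gamma> f) = ereal (\<beta> f) + integral_star m f)"
proof -
  interpret star_ordering ge
    by unfold_locales (rule ge)
  interpret function_subspace L
    by (rule function_subspace_vector_lattice[OF L])
  have \<gamma>: "sublinear \<gamma>"
    using sub hom by (simp add: sublinear_def)
  obtain \<phi> where lin: "linear_functional \<phi>" and le: "\<And>f. f \<in> L \<Longrightarrow> \<phi> f \<le> \<gamma> f"
    and eq: "\<And>f. f \<in> C \<Longrightarrow> \<phi> f = \<gamma> f"
  proof -
    have "\<exists>\<phi>. linear_functional \<phi> \<and> (\<forall>f\<in>L. \<phi> f \<le> \<gamma> f) \<and> (\<forall>f\<in>C. \<phi> f = \<gamma> f)"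
      using \<gamma> C additive by (rule hahn_banach_additive_on_convex)
    then show thesis
      using that by blast
  qed
  \<comment> \<open>Domination transfers monotonicity:
    \<open>\<phi> (g - f) \<le> \<gamma> (g - f) \<le> \<gamma> 0 = 0\<close>.\<close>
  have \<phi>_mono: "\<phi> g \<le> \<phi> f" if f: "f \<in> L" and g: "g \<in> L" and fg: "ge f g" for f g
  proof -
    have "ge (\<lambda>_. 0) (\<lambda>x. g x - f x)"
      using ge_add[OF fg, of "\<lambda>x. - f x"] by simp
    then have "\<gamma> (\<lambda>x. g x - f x) \<le> 0"
      using mono zero diff[OF g f] sublinear_zero[OF \<gamma>] unfolding star_monotone_on_def by fastforce
    then show ?thesis
      using le[OF diff[OF g f]] linear_diff[OF lin g f] by simp
  qed
  have bdd: "f \<in> L" if "\<And>x. \<bar>f x\<bar> \<le> c" for f c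
  proof -
    have "f \<in> bounded_star ge"
      using that by (rule bounded_starI)
    then show ?thesis
      using BL by blast
  qed
  have pos: "\<phi> f \<ge> 0" if fL: "f \<in> L" and f: "\<And>x. f x \<ge> 0" for f
  proof -
    have "ge f (\<lambda>_. 0)"
      using f by (rule order_rules(3))
    then show ?thesis
      using \<phi>_mono[OF fL zero] linear_zero[OF lin] by simp
  qed
  interpret positive_functional L \<phi>
    by unfold_locales (fact bdd vector_lattice_abs[OF L] lin pos)+
  have int: "integral_star \<mu> f = ereal (ds_integral \<mu> f)" if "f \<in> L" for f
    using that subset_L1 by (intro \<mu>.integral_star_eq_ds_integral) auto
  \<comment> \<open>Star-monotonicity applied to \<open>0 \<ge>_* 1_A\<close> gives
    \<open>\<mu> A \<le> 0\<close>, and positivity gives the other inequality.\<close>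
  have "\<mu> A = 0" if "A \<in> null_sets_star ge" for A
  proof -
    have "\<phi> (indicator A) \<le> \<phi> (\<lambda>_. 0)"
      using that by (intro \<phi>_mono zero indicator_mem) (simp add: null_sets_star_def)
    then show ?thesis
      using \<mu>.nonneg[of A] linear_zero[OF lin] by (simp add: \<mu>_def)
  qed
  then have "\<mu> \<in> ba_star_plus ge"
    using \<mu>.nonneg \<mu>.Un_disjoint \<mu>.mono[OF subset_UNIV] unfolding ba_star_plus_def by blast
  moreover have "\<phi> f - ds_integral \<mu> f = 0" if "f \<in> bounded_star ge" for f
  proof -
    have "f \<in> L"
      using that BL by blast
    then have "ds_integral \<mu> f = \<phi> f"
      using positive_functional_axioms \<phi>_mono that by (intro ds_integral_eq_of_bounded_star)
    then show ?thesis
      by simp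
  qed
  \<comment> \<open>With this \<open>\<beta>\<close> the sum of \<open>\<beta>\<close> and the
    integral is \<open>\<phi>\<close>, so the two final claims are
    \<open>\<phi> \<le> \<gamma>\<close> on \<open>L\<close> and \<open>\<phi> = \<gamma>\<close> on
    \<open>C\<close>.\<close>
  ultimately show ?thesis
    using positive_linear_on_singular_part subset_L1 le eq C(1) int
    by (intro exI[of _ "\<lambda>f. \<phi> f - ds_integral \<mu> f"] exI[of _ \<mu>]) (auto simp: subset_eq)
qed

text \<open>The sum of the \<open>fs i\<close> may leave \<open>C\<close>, where only the inequality
  is available. This is enough: the linear minorant touches \<open>\<gamma>\<close> at each summand,
  so its value at the sum bounds \<open>\<gamma>\<close> of the sum from below by the sum of the
  values of \<open>\<gamma>\<close>.\<close>

lemma additive_of_decomposition: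
  assumes L: "vector_lattice L" and C: "C \<subseteq> L"
    and sub: "subadditive_on L \<gamma>" and hom: "pos_homogeneous_on L \<gamma>"
    and \<beta>: "positive_linear_on L \<beta>" and m: "m \<in> ba_star_plus ge" and L1: "L \<subseteq> L1 m"
    and ge: "\<And>h. h \<in> L \<Longrightarrow> ereal (\<gamma> h) \<ge> ereal (\<beta> h) + integral_star m h"
    and eq: "\<And>f. f \<in> C \<Longrightarrow> ereal (\<gamma> f) = ereal (\<beta> f) + integral_star m f"
    and fs: "\<And>i. i \<in> I \<Longrightarrow> fs i \<in> C"
  shows "\<gamma> (\<lambda>x. \<Sum>i\<in>I. fs i x) = (\<Sum>i\<in>I. \<gamma> (fs i))"
proof -
  interpret function_subspace L
    by (rule function_subspace_vector_lattice[OF L])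
  interpret fin_additive m
    using m by unfold_locales (auto simp: ba_star_plus_def)
  have \<gamma>: "sublinear \<gamma>"
    using sub hom by (simp add: sublinear_def)
  define \<phi> where "\<phi> f = \<beta> f + ds_integral m f" for f
  have lin: "linear_functional \<phi>"
    using \<beta> L1 L1_add(2) L1_scale
    by (auto simp: linear_functional_def \<phi>_def positive_linear_on_def subset_eq distrib_left)
  have int: "ereal (\<beta> f) + integral_star m f = ereal (\<phi> f)" if "f \<in> L" for f
    using that L1 by (simp add: \<phi>_def integral_star_eq_ds_integral subset_eq)
  have fsL: "fs i \<in> L" if "i \<in> I" for i
    using fs[OF that] C by blast
  have sumL: "(\<lambda>x. \<Sum>i\<in>I. fs i x) \<in> L"
    using fsL by (rule sum)
  show ?thesis
  proof (rule antisym)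
    show "\<gamma> (\<lambda>x. \<Sum>i\<in>I. fs i x) \<le> (\<Sum>i\<in>I. \<gamma> (fs i))"
      using fsL
    \<comment> \<open>Over an infinite index set both sums are 0 by convention, and the claim
      becomes \<open>\<gamma> 0 \<le> 0\<close>.\<close>
    proof (induction I rule: infinite_finite_induct)
      case (insert i I)
      have "\<gamma> (\<lambda>x. fs i x + (\<Sum>j\<in>I. fs j x)) \<le> \<gamma> (fs i) + \<gamma> (\<lambda>x. \<Sum>j\<in>I. fs j x)"
        using insert.prems by (intro sublinearD(1)[OF \<gamma>] sum) auto
      then show ?case
        using insert by fastforce
    qed (simp_all add: sublinear_zero[OF \<gamma>])
    have "(\<Sum>i\<in>I. \<gamma> (fs i)) = (\<Sum>i\<in>I. \<phi> (fs i))"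
      using eq[OF fs] int[OF fsL] by (intro sum.cong) auto
    also have "\<dots> = \<phi> (\<lambda>x. \<Sum>i\<in>I. fs i x)"
      by (rule linear_sum[OF lin fsL, symmetric])
    also have "\<dots> \<le> \<gamma> (\<lambda>x. \<Sum>i\<in>I. fs i x)"
      using ge[OF sumL] int[OF sumL] by simp
    finally show "(\<Sum>i\<in>I. \<gamma> (fs i)) \<le> \<gamma> (\<lambda>x. \<Sum>i\<in>I. fs i x)" .
  qed
qed

theorem theorem9:
  fixes ge :: "('a \<Rightarrow> real) \<Rightarrow> ('a \<Rightarrow> real) \<Rightarrow> bool"
    and L C :: "('a \<Rightarrow> real) set"
    and \<gamma> :: "('a \<Rightarrow> real) \<Rightarrow> real"
  assumes "star_order ge"
    and "vector_lattice L"
    and "bounded_star ge \<subseteq> L"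
    and "C \<subseteq> L" and "convex_fn_set C" and "(\<lambda>_. 0) \<in> C"
    and "star_monotone_on ge L \<gamma>"
    and "subadditive_on L \<gamma>"
    and "pos_homogeneous_on L \<gamma>"
  shows "(\<forall>N::nat. \<forall>fs :: nat \<Rightarrow> 'a \<Rightarrow> real. (\<forall>n\<in>{1..N}. fs n \<in> C) \<longrightarrow>
            \<gamma> (\<lambda>x. \<Sum>n=1..N. fs n x) = (\<Sum>n=1..N. \<gamma> (fs n)))
    \<longleftrightarrow>
    (\<exists>\<beta> m. positive_linear_on L \<beta> \<and> (\<forall>f\<in>bounded_star ge. \<beta> f = 0) \<and>
       m \<in> ba_star_plus ge \<and> L \<subseteq> L1 m \<and>
       (\<forall>h\<in>L. ereal (\<gamma> h) \<ge> ereal (\<beta> h) + integral_star m h) \<and>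
       (\<forall>f\<in>C. ereal (\<gamma> f) = ereal (\<beta> f) + integral_star m f))"
  (is "?additive \<longleftrightarrow> ?decomposition")
proof
  assume ?additive
  then have additive: "\<gamma> (\<lambda>x. \<Sum>n=1..N. fs n x) = (\<Sum>n=1..N. \<gamma> (fs n))"
    if "\<And>n. fs n \<in> C" for N and fs :: "nat \<Rightarrow> 'a \<Rightarrow> real"
    using that by blast
  \<comment> \<open>Take \<open>N = 2\<close> with \<open>f\<close> at index 1 and \<open>g\<close>
    at every other index, so that the whole sequence stays in \<open>C\<close>.\<close>
  have "\<gamma> (\<lambda>x. f x + g x) = \<gamma> f + \<gamma> g" if "f \<in> C" "g \<in> C" for f g
    using additive[of "\<lambda>n. if n = 1 then f else g" 2] that by (simp add: numeral_2_eq_2)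
  with assms show ?decomposition
    by (intro decomposition_exists)
next
  assume ?decomposition
  then obtain \<beta> m where "positive_linear_on L \<beta>" "m \<in> ba_star_plus ge" "L \<subseteq> L1 m"
    and "\<And>h. h \<in> L \<Longrightarrow> ereal (\<gamma> h) \<ge> ereal (\<beta> h) + integral_star m h"
    and "\<And>f. f \<in> C \<Longrightarrow> ereal (\<gamma> f) = ereal (\<beta> f) + integral_star m f"
    by blast
  note decomposition = this
  show ?additive
  proof (intro allI impI)
    fix N and fs :: "nat \<Rightarrow> 'a \<Rightarrow> real" assume "\<forall>n\<in>{1..N}. fs n \<in> C"
    then have fs: "fs n \<in> C" if "n \<in> {1..N}" for n
      using that by blast
    show "\<gamma> (\<lambda>x. \<Sum>n=1..N. fs n x) = (\<Sum>n=1..N. \<gamma> (fs n))"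
      by (rule additive_of_decomposition[where L = L and C = C and \<beta> = \<beta> and m = m and ge = ge])
        (fact assms decomposition fs)+
  qed
qed

end
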